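(* Let $\mathcal G$ be a finite simple digraph with edges colored by a finite set $I$ (a move-minimizing game digraph), and suppose $\mathcal G$ is the order diagram of a diamond-colored modular lattice $L$ with rank function $\rho$. Let $\mathbf s,\mathbf t\in\mathcal G$. If $L$ is distributive, let $P:=\mathbf j_{color}(L)$ be its vertex-colored poset of join irreducibles and identify $\mathbf s$ and $\mathbf t$ with order ideals from $P$, so that $\mathbf s$ and $\mathbf t$ are subsets of $P$. Then: (0) There exists a path in $\mathcal G$ from $\mathbf s$ to $\mathbf t$. (1) The distance from $\mathbf s$ to $\mathbf t$ is $2\rho(\mathbf s\vee\mathbf t)-\rho(\mathbf s)-\rho(\mathbf t)=\rho(\mathbf s)+\rho(\mathbf t)-2\rho(\mathbf s\wedge\mathbf t)$. If $L$ is distributive, then $\rho(\mathbf s)=|\mathbf s|$, $\rho(\mathbf t)=|\mathbf t|$, $\rho(\mathbf s\vee\mathbf t)=|\mathbf s\cup\mathbf t|$ and $\rho(\mathbf s\wedge\mathbf t)=|\mathbf s\cap\mathbf t|$. (2) For any given $i\in I$, any two shortest paths from $\mathbf s$ to $\mathbf t$ have the same number of color $i$ edges. If $L$ is distributive, this number is the number of color $i$ vertices in $(\mathbf s\cup\mathbf t)-\mathbf s$ plus the number of color $i$ vertices in $(\mathbf s\cup\mathbf t)-\mathbf t$, or equivalently the number of color $i$ vertices in $\mathbf s-(\mathbf s\cap\mathbf t)$ plus the number of color $i$ vertices in $\mathbf t-(\mathbf s\cap\mathbf t)$. (3) Suppose $L$ is distributive. Let $\ell_1:=|\mathbf s\cup\mathbf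 t|-|\mathbf s|$ and $\ell_2:=|\mathbf s\cup\mathbf t|-|\mathbf t|$. Let $\mathbf x_0:=\mathbf s$; for $1\le j\le\ell_1$ (taken in increasing order), let $u$ be any minimal element of $(\mathbf s\cup\mathbf t)-\mathbf x_{j-1}$ and put $\mathbf x_j:=\mathbf x_{j-1}\cup\{u\}$. Let $\mathbf x_{\ell_1+\ell_2}:=\mathbf t$; for $1\le j\le\ell_2$ (taken in decreasing order), let $u$ be any minimal element of $(\mathbf s\cup\mathbf t)-\mathbf x_{\ell_1+j}$ and put $\mathbf x_{\ell_1+j-1}:=\mathbf x_{\ell_1+j}\cup\{u\}$. Then each $\mathbf x_j$ ($0\le j\le\ell_1+\ell_2$) is an order ideal from $P$, and $(\mathbf x_0,\mathbf x_1,\dots,\mathbf x_{\ell_1+\ell_2})$ is a shortest path from $\mathbf s$ to $\mathbf t$ with $\mathbf x_{\ell_1}=\mathbf s\cup\mathbf t$. Similarly, let $k_1=|\mathbf s|-|\mathbf s\cap\mathbf t|$ and $k_2=|\mathbf t|-|\mathbf s\cap\mathbf t|$; set $\mathbf y_0:=\mathbf s$, and for $1\le j\le k_1$ let $\mathbf y_j:=\mathbf y_{j-1}-\{u\}$ with $u$ any maximal element of $\mathbf y_{j-1}-(\mathbf s\cap\mathbf t)$; set $\mathbf y_{k_1+k_2}:=\mathbf t$, and for $1\le j\le k_2$ (in decreasing order) let $\mathbf y_{k_1+j-1}:=\mathbf y_{k_1+j}-\{u\}$ with $u$ any maximal element of $\mathbf y_{k_1+j}-(\mathbf s\cap\mathbf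 t)$. Then $(\mathbf s=\mathbf y_0,\mathbf y_1,\dots,\mathbf y_{k_1+k_2}=\mathbf t)$ is a shortest path from $\mathbf s$ to $\mathbf t$ with $\mathbf y_{k_1}=\mathbf s\cap\mathbf t$.
   Context: All posets and lattices are finite. The order diagram of a poset has a directed edge $\mathbf x\to\mathbf y$ iff $\mathbf y$ covers $\mathbf x$; a poset is edge-colored by $I$ if every such edge has a color in $I$ ($\mathbf x\xrightarrow{i}\mathbf y$). It is diamond-colored if, whenever $\mathbf v\to\mathbf s$, $\mathbf v\to\mathbf t$, $\mathbf s\to\mathbf u$, $\mathbf t\to\mathbf u$ with $\mathbf s\ne\mathbf t$, the edges $\mathbf v\to\mathbf s$ and $\mathbf t\to\mathbf u$ have the same color and the edges $\mathbf v\to\mathbf t$ and $\mathbf s\to\mathbf u$ have the same color. The rank function $\rho$ of a modular lattice is normalized by $\rho(\min L)=0$ and increases by $1$ along every edge. A path from $\mathbf s$ to $\mathbf t$ is a sequence $(\mathbf s=\mathbf z_0,\mathbf z_1,\dots,\mathbf z_m=\mathbf t)$ such that for each $j$ either $\mathbf z_{j-1}\to\mathbf z_j$ or $\mathbf z_j\to\mathbf z_{j-1}$ (edges may be traversed in either direction); its length is $m\geq 0$. The distance is the minimum length of a path, and a shortest path is one attaining it. For a diamond-colored distributive lattice $L$, $\mathbf j_{color}(L)$ is the set of join irreducible elements (elements covering exactly one element) with the order induced from $L$, where a join irreducible $\mathbf x$, covering $\mathbf x'$, is colored by the color of the edge $\mathbf x'\to\mathbf x$. An order ideal of $P$ is a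 down-closed subset. Elements $\mathbf s\in L$ are identified with order ideals from $P=\mathbf j_{color}(L)$ via $\mathbf s\mapsto\{p\in P: p\le\mathbf s\}$; under this identification $\le$ is $\subseteq$, $\vee$ is $\cup$, $\wedge$ is $\cap$, and an edge $\mathbf x\to\mathbf y$ with $\mathbf y-\mathbf x=\{v\}$ has the color of $v$. *)

theory Defs
  imports "HOL-Algebra.Lattice" "Graph_Theory.Pair_Digraph"
begin

section \<open>Order diagrams and diamond colorings\<close>

definition covers :: "('a, 'm) gorder_scheme \<Rightarrow> 'a \<Rightarrow> 'a \<Rightarrow> bool" where
  "covers L y x \<longleftrightarrow> x \<in> carrier L \<and> y \<in> carrier L \<and> x \<sqsubset>\<^bsub>L\<^esub> y \<and>
     \<not> (\<exists>z\<in>carrier L. x \<sqsubset>\<^bsub>L\<^esub> z \<and> z \<sqsubset>\<^bsub>L\<^esub> y)"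

definition is_order_diagram :: "'a pair_pre_digraph \<Rightarrow> ('a, 'm) gorder_scheme \<Rightarrow> bool" where
  "is_order_diagram G L \<longleftrightarrow>
     pverts G = carrier L \<and> parcs G = {(x, y). covers L y x}"

definition edge_colored_by ::
    "'a pair_pre_digraph \<Rightarrow> ('a \<times> 'a \<Rightarrow> 'i) \<Rightarrow> 'i set \<Rightarrow> bool" where
  "edge_colored_by G col I \<longleftrightarrow> (\<forall>e\<in>parcs G. col e \<in> I)"

definition diamond_colored :: "'a pair_pre_digraph \<Rightarrow> ('a \<times> 'a \<Rightarrow> 'i) \<Rightarrow> bool" where
  "diamond_colored G col \<longleftrightarrow>
     (\<forall>v s t u. (v, s) \<in> parcs G \<and> (v, t) \<in> parcs G \<and> (s, u) \<in> parcs G \<and> (t, u) \<in> parcs G \<and> s \<noteq> t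
        \<longrightarrow> col (v, s) = col (t, u) \<and> col (v, t) = col (s, u))"

section \<open>Modular and distributive lattices\<close>

definition modular_lattice :: "('a, 'm) gorder_scheme \<Rightarrow> bool" where
  "modular_lattice L \<longleftrightarrow> lattice L \<and>
     (\<forall>x\<in>carrier L. \<forall>y\<in>carrier L. \<forall>z\<in>carrier L.
        x \<sqsubseteq>\<^bsub>L\<^esub> z \<longrightarrow> x \<squnion>\<^bsub>L\<^esub> (y \<sqinter>\<^bsub>L\<^esub> z) = (x \<squnion>\<^bsub>L\<^esub> y) \<sqinter>\<^bsub>L\<^esub> z)"

definition distributive_lattice :: "('a, 'm) gorder_scheme \<Rightarrow> bool" where
  "distributive_lattice L \<longleftrightarrow> lattice L \<and>
     (\<forall>x\<in>carrier L. \<forall>y\<in>carrier L. \<forall>z\<in>carrier L.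
        x \<sqinter>\<^bsub>L\<^esub> (y \<squnion>\<^bsub>L\<^esub> z) = (x \<sqinter>\<^bsub>L\<^esub> y) \<squnion>\<^bsub>L\<^esub> (x \<sqinter>\<^bsub>L\<^esub> z))"

definition is_rank_function :: "('a, 'm) gorder_scheme \<Rightarrow> ('a \<Rightarrow> nat) \<Rightarrow> bool" where
  "is_rank_function L \<rho> \<longleftrightarrow> \<rho> \<bottom>\<^bsub>L\<^esub> = 0 \<and> (\<forall>x y. covers L y x \<longrightarrow> \<rho> y = \<rho> x + 1)"

section \<open>Paths traversing edges in either direction\<close>

text \<open>The path (z_0, ..., z_m) is the nonempty list [z_0, ..., z_m]. The walks of the
  Graph_Theory library follow edges forwards only, hence they are not used here.\<close>

definition is_path :: "'a pair_pre_digraph \<Rightarrow> 'a \<Rightarrow> 'a list \<Rightarrow> 'a \<Rightarrow> bool" where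
  "is_path G s p t \<longleftrightarrow> p \<noteq> [] \<and> hd p = s \<and> last p = t \<and> set p \<subseteq> pverts G \<and>
     successively (\<lambda>x y. (x, y) \<in> parcs G \<or> (y, x) \<in> parcs G) p"

definition path_length :: "'a list \<Rightarrow> nat" where
  "path_length p = length p - 1"

text \<open>Meaningful only if some path from s to t exists.\<close>

definition path_distance :: "'a pair_pre_digraph \<Rightarrow> 'a \<Rightarrow> 'a \<Rightarrow> nat" where
  "path_distance G s t = (LEAST m. \<exists>p. is_path G s p t \<and> path_length p = m)"

definition shortest_path :: "'a pair_pre_digraph \<Rightarrow> 'a \<Rightarrow> 'a list \<Rightarrow> 'a \<Rightarrow> bool" where
  "shortest_path G s p t \<longleftrightarrow> is_path G s p t \<and> path_length p = path_distance G s t"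

text \<open>The color of the edge joining two consecutive vertices of a path, in whichever direction
  that edge points. In an order diagram at most one of the two directions occurs.\<close>

definition step_color :: "'a pair_pre_digraph \<Rightarrow> ('a \<times> 'a \<Rightarrow> 'i) \<Rightarrow> 'a \<Rightarrow> 'a \<Rightarrow> 'i" where
  "step_color G col x y = (if (x, y) \<in> parcs G then col (x, y) else col (y, x))"

definition color_count :: "'a pair_pre_digraph \<Rightarrow> ('a \<times> 'a \<Rightarrow> 'i) \<Rightarrow> 'i \<Rightarrow> 'a list \<Rightarrow> nat" where
  "color_count G col i p =
     card {j. j < path_length p \<and> step_color G col (p ! j) (p ! Suc j) = i}"

section \<open>Join irreducibles and order ideals\<close>

definition join_irreducible :: "('a, 'm) gorder_scheme \<Rightarrow> 'a \<Rightarrow> bool" where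
  "join_irreducible L x \<longleftrightarrow> x \<in> carrier L \<and> (\<exists>!x'. covers L x x')"

text \<open>The vertex-colored poset of join irreducibles consists of the poset \<open>j_poset L\<close>
  together with the coloring \<open>j_color L col\<close> of its elements.\<close>

definition j_poset :: "('a, 'm) gorder_scheme \<Rightarrow> ('a, 'm) gorder_scheme" where
  "j_poset L = L\<lparr>carrier := {x. join_irreducible L x}\<rparr>"

definition j_color :: "('a, 'm) gorder_scheme \<Rightarrow> ('a \<times> 'a \<Rightarrow> 'i) \<Rightarrow> 'a \<Rightarrow> 'i" where
  "j_color L col x = col ((THE x'. covers L x x'), x)"

definition order_ideal :: "('a, 'm) gorder_scheme \<Rightarrow> 'a set \<Rightarrow> bool" where
  "order_ideal P A \<longleftrightarrow> A \<subseteq> carrier P \<and> (\<forall>x\<in>A. \<forall>y\<in>carrier P. y \<sqsubseteq>\<^bsub>P\<^esub> x \<longrightarrow> y \<in> A)"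

text \<open>The order ideal from \<open>j_poset L\<close> with which a lattice element is identified.\<close>

definition ideal_of :: "('a, 'm) gorder_scheme \<Rightarrow> 'a \<Rightarrow> 'a set" where
  "ideal_of L s = {p \<in> carrier (j_poset L). p \<sqsubseteq>\<^bsub>L\<^esub> s}"

definition minimal_elem :: "('a, 'm) gorder_scheme \<Rightarrow> 'a set \<Rightarrow> 'a \<Rightarrow> bool" where
  "minimal_elem P A u \<longleftrightarrow> u \<in> A \<and> \<not> (\<exists>v\<in>A. v \<sqsubset>\<^bsub>P\<^esub> u)"

definition maximal_elem :: "('a, 'm) gorder_scheme \<Rightarrow> 'a set \<Rightarrow> 'a \<Rightarrow> bool" where
  "maximal_elem P A u \<longleftrightarrow> u \<in> A \<and> \<not> (\<exists>v\<in>A. u \<sqsubset>\<^bsub>P\<^esub> v)"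

section \<open>Constructing shortest paths of order ideals\<close>

definition adds_minimal :: "('a, 'm) gorder_scheme \<Rightarrow> 'a set \<Rightarrow> 'a set \<Rightarrow> 'a set \<Rightarrow> bool" where
  "adds_minimal P U A B \<longleftrightarrow> (\<exists>u. minimal_elem P (U - A) u \<and> B = A \<union> {u})"

definition removes_maximal :: "('a, 'm) gorder_scheme \<Rightarrow> 'a set \<Rightarrow> 'a set \<Rightarrow> 'a set \<Rightarrow> bool" where
  "removes_maximal P W A B \<longleftrightarrow> (\<exists>u. maximal_elem P (A - W) u \<and> B = A - {u})"

text \<open>A construction of \<open>X 0, ..., X (a + b)\<close> whose steps are instances of a relation R runs in
  two phases that meet at index a. Phase one computes \<open>X 1, ..., X a\<close> upwards from \<open>X 0 = S\<close>,
  and \<open>fwd_run\<close> says that the indices up to n have been carried out. Phase two computes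
  \<open>X (a + b - 1), ..., X a\<close> downwards from \<open>X (a + b) = T\<close>, and \<open>bwd_run\<close> says that X has been
  computed down to index a + n. The value at index a is produced by both phases, so the two
  phases are kept apart and their agreement at a has to be proved.\<close>

definition fwd_run ::
    "('a set \<Rightarrow> 'a set \<Rightarrow> bool) \<Rightarrow> 'a set \<Rightarrow> nat \<Rightarrow> (nat \<Rightarrow> 'a set) \<Rightarrow> bool" where
  "fwd_run R S n X \<longleftrightarrow> X 0 = S \<and> (\<forall>j\<in>{1..n}. R (X (j - 1)) (X j))"

definition bwd_run ::
    "('a set \<Rightarrow> 'a set \<Rightarrow> bool) \<Rightarrow> 'a set \<Rightarrow> nat \<Rightarrow> nat \<Rightarrow> nat \<Rightarrow> (nat \<Rightarrow> 'a set) \<Rightarrow> bool" where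
  "bwd_run R T a b n X \<longleftrightarrow> X (a + b) = T \<and> (\<forall>j\<in>{n + 1..b}. R (X (a + j)) (X (a + j - 1)))"

definition glue :: "nat \<Rightarrow> (nat \<Rightarrow> 'a set) \<Rightarrow> (nat \<Rightarrow> 'a set) \<Rightarrow> nat \<Rightarrow> 'a set" where
  "glue a X X' j = (if j \<le> a then X j else X' j)"

text \<open>The sequence \<open>X 0, ..., X n\<close> of order ideals is a shortest path from s to t, under the
  identification of lattice elements with order ideals.\<close>

definition ideals_shortest_path ::
    "'a pair_pre_digraph \<Rightarrow> ('a, 'm) gorder_scheme \<Rightarrow> 'a \<Rightarrow> (nat \<Rightarrow> 'a set) \<Rightarrow> nat \<Rightarrow> 'a \<Rightarrow> bool" where
  "ideals_shortest_path G L s X n t \<longleftrightarrow>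
     (\<exists>p. shortest_path G s p t \<and> map (ideal_of L) p = map X [0..<Suc n])"

end

theory Submission
  imports Defs "HOL-Library.Multiset"
begin

text \<open>
  Two properties of a finite modular lattice carry the proof. The first is semimodularity
  (\<open>cover_join\<close>, \<open>join_cover_step\<close>): if \<open>y\<close> covers \<open>x\<close>, then \<open>y \<squnion> t\<close> equals or covers \<open>x \<squnion> t\<close>. Along a path that
  ends in \<open>t\<close>, one edge therefore changes \<open>2 * \<rho> (z \<squnion> t) - \<rho> z - \<rho> t\<close> by exactly one, up or down.
  This quantity vanishes at \<open>z = t\<close>, so it is a lower bound for the length of any path
  (\<open>path_length_ge\<close>). It is attained by climbing inside the interval up to \<open>s \<squnion> t\<close> and then
  descending to \<open>t\<close> (\<open>ex_path\<close>), so it is the distance. The version with \<open>s \<sqinter> t\<close> follows from the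
  modular identity for \<open>\<rho>\<close> (\<open>rank_meet_join\<close>).

  The second property is that the multiset of colors along a saturated chain depends only on the ends
  of the chain (\<open>chain_unique\<close>): two chains that leave \<open>x\<close> by different edges can be
  rerouted through a diamond, on which opposite edges have equal colors. Stacking diamonds also
  shows that joining a whole chain with an element that covers its bottom preserves all colors
  (\<open>chain_transport\<close>). Every edge of a shortest path must decrease the quantity above, and
  transport then shows, edge by edge, that the colors of the path are those of a chain from \<open>s\<close> to
  \<open>s \<squnion> t\<close> together with those of a chain from \<open>t\<close> to \<open>s \<squnion> t\<close> (\<open>color_count_shortest_path\<close>).
  These do not depend on the path.

  In the distributive case, Birkhoff's correspondence between lattice elements and order ideals
  translates this into sets: along an edge exactly one join irreducible is gained, and transport
  shows that it has the color of the edge (\<open>ideal_cover\<close>). Adding minimal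
  elements of \<open>(S \<union> T) - X\<close> one at a time keeps \<open>X\<close> an order ideal and raises its size by one,
  hence it follows edges and arrives at \<open>S \<union> T\<close> after the number of steps that the distance formula
  predicts (\<open>adding_minimal_elements\<close>); removal of maximal elements down to \<open>S \<inter> T\<close> is similar.
\<close>

section \<open>Minimal elements, covers and order ideals of finite posets\<close>

lemma fwd_run_step:
  assumes "fwd_run R S n X" "j < n"
  shows "R (X j) (X (Suc j))"
proof -
  have "\<forall>j\<in>{1..n}. R (X (j - 1)) (X j)" using assms(1) by (simp add: fwd_run_def)
  from bspec[OF this, of "Suc j"] show ?thesis using assms(2) by simp
qed

context partial_order
begin

lemma lless_iff: "x \<sqsubset> y \<longleftrightarrow> x \<sqsubseteq> y \<and> x \<noteq> y"
  by (simp add: lless_def eq_is_equal)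

lemma coversD:
  assumes "covers L y x"
  shows "x \<in> carrier L" "y \<in> carrier L" "x \<sqsubseteq> y" "x \<noteq> y" "\<not> y \<sqsubseteq> x"
  using assms by (auto simp: covers_def lless_iff)

lemma covers_between:
  assumes "covers L y x" "z \<in> carrier L" "x \<sqsubseteq> z" "z \<sqsubseteq> y"
  shows "z = x \<or> z = y"
  using assms by (auto simp: covers_def lless_iff)

lemma coversI:
  assumes "x \<in> carrier L" "y \<in> carrier L" "x \<sqsubseteq> y" "x \<noteq> y"
    and "\<And>z. z \<in> carrier L \<Longrightarrow> x \<sqsubseteq> z \<Longrightarrow> z \<sqsubseteq> y \<Longrightarrow> z = x \<or> z = y"
  shows "covers L y x"
  using assms by (auto simp: covers_def lless_iff)

text \<open>The number of elements of \<open>A\<close> below a given one increases strictly with that element, so an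
  element where it is smallest is minimal.\<close>

lemma ex_minimal_elem:
  assumes "finite A" "A \<noteq> {}" "A \<subseteq> carrier L"
  shows "\<exists>u. minimal_elem L A u"
proof -
  let ?h = "\<lambda>x. card {w \<in> A. w \<sqsubseteq> x}"
  obtain u where u: "u \<in> A" "\<And>v. v \<in> A \<Longrightarrow> ?h u \<le> ?h v"
    using ex_has_least_nat[of "\<lambda>x. x \<in> A" _ ?h] assms(2) by blast
  have "\<not> v \<sqsubset> u" if v: "v \<in> A" for v
  proof
    assume "v \<sqsubset> u"
    then have le: "v \<sqsubseteq> u" and ne: "v \<noteq> u" by (auto simp: lless_iff)
    have "u \<in> {w \<in> A. w \<sqsubseteq> u}" "u \<notin> {w \<in> A. w \<sqsubseteq> v}"
      using le ne v u(1) assms(3) by auto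
    moreover have "{w \<in> A. w \<sqsubseteq> v} \<subseteq> {w \<in> A. w \<sqsubseteq> u}"
      using le v u(1) assms(3) le_trans[of _ v u] by (auto simp: subset_iff)
    ultimately have "{w \<in> A. w \<sqsubseteq> v} \<subset> {w \<in> A. w \<sqsubseteq> u}" by blast
    then have "?h v < ?h u" using assms(1) by (intro psubset_card_mono) auto
    then show False using u(2)[OF v] by simp
  qed
  then show ?thesis using u(1) by (auto simp: minimal_elem_def)
qed

lemma partial_order_dual: "partial_order (inv_gorder L)"
proof -
  interpret dual: weak_partial_order "inv_gorder L" by (rule dual_weak_order)
  show ?thesis by unfold_locales (simp add: eq_is_equal)
qed

lemma ex_maximal_elem:
  assumes "finite A" "A \<noteq> {}" "A \<subseteq> carrier L"
  shows "\<exists>u. maximal_elem L A u"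
proof -
  interpret dual: partial_order "inv_gorder L" by (rule partial_order_dual)
  obtain u where "minimal_elem (inv_gorder L) A u"
    using dual.ex_minimal_elem[of A] assms by auto
  then have "maximal_elem L A u"
    by (auto simp: minimal_elem_def maximal_elem_def lless_iff dual.lless_iff)
  then show ?thesis ..
qed

lemma ex_cover_above:
  assumes "finite (carrier L)" "x \<in> carrier L" "y \<in> carrier L" "x \<sqsubseteq> y" "x \<noteq> y"
  shows "\<exists>z. covers L z x \<and> z \<sqsubseteq> y"
proof -
  let ?A = "{z \<in> carrier L. x \<sqsubset> z \<and> z \<sqsubseteq> y}"
  have "y \<in> ?A" using assms by (simp add: lless_iff)
  then obtain z where z: "minimal_elem L ?A z"
    using ex_minimal_elem[of ?A] assms(1) by auto
  then have zA: "z \<in> carrier L" "x \<sqsubset> z" "z \<sqsubseteq> y" and min: "\<And>w. w \<in> ?A \<Longrightarrow> \<not> w \<sqsubset> z"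
    unfolding minimal_elem_def by auto
  have "\<not> w \<sqsubset> z" if "w \<in> carrier L" "x \<sqsubset> w" for w
    using min[of w] that zA le_trans[of w z y] assms(3) by (auto simp: lless_iff)
  then have "covers L z x" using zA assms(2) by (auto simp: covers_def)
  then show ?thesis using z by (auto simp: minimal_elem_def)
qed

lemma ex_cover_below:
  assumes "finite (carrier L)" "x \<in> carrier L" "y \<in> carrier L" "x \<sqsubseteq> y" "x \<noteq> y"
  shows "\<exists>z. covers L y z \<and> x \<sqsubseteq> z"
proof -
  let ?A = "{z \<in> carrier L. x \<sqsubseteq> z \<and> z \<sqsubset> y}"
  have "x \<in> ?A" using assms by (simp add: lless_iff)
  then obtain z where z: "maximal_elem L ?A z"
    using ex_maximal_elem[of ?A] assms(1) by auto
  then have zA: "z \<in> carrier L" "x \<sqsubseteq> z" "z \<sqsubset> y" and max: "\<And>w. w \<in> ?A \<Longrightarrow> \<not> z \<sqsubset> w"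
    unfolding maximal_elem_def by auto
  have "\<not> z \<sqsubset> w" if "w \<in> carrier L" "w \<sqsubset> y" for w
    using max[of w] that zA le_trans[of x z w] assms(2) by (auto simp: lless_iff)
  then have "covers L y z" using zA assms(3) by (auto simp: covers_def)
  then show ?thesis using z by (auto simp: maximal_elem_def)
qed

text \<open>Induction upwards along a saturated chain that starts at \<open>x\<close>.\<close>

lemma le_cover_induct [consumes 4, case_names base step]:
  assumes "finite (carrier L)" "x \<in> carrier L" "y \<in> carrier L" "x \<sqsubseteq> y"
    and base: "P x"
    and step: "\<And>y z. \<lbrakk>z \<in> carrier L; x \<sqsubseteq> z; covers L y z; P z\<rbrakk> \<Longrightarrow> P y"
  shows "P y"
  using assms(3,4)
proof (induction "card {w \<in> carrier L. w \<sqsubseteq> y}" arbitrary: y rule: less_induct)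
  case less
  show ?case
  proof (cases "x = y")
    case True
    then show ?thesis using base by simp
  next
    case False
    then obtain z where z: "covers L y z" "x \<sqsubseteq> z"
      using ex_cover_below assms(1,2) less.prems by blast
    note zD = coversD[OF z(1)]
    have "{w \<in> carrier L. w \<sqsubseteq> z} \<subset> {w \<in> carrier L. w \<sqsubseteq> y}"
      using zD le_trans[of _ z y] by auto
    then have "P z"
      using less.hyps[OF psubset_card_mono] assms(1) zD(1) z(2) by simp
    then show ?thesis using step zD z by blast
  qed
qed

text \<open>What lies strictly below a minimal element of \<open>U - A\<close> is in \<open>U\<close>, which is down-closed, and so by
  minimality in \<open>A\<close>.\<close>

lemma order_ideal_add_minimal:
  assumes "order_ideal L A" "order_ideal L U" "minimal_elem L (U - A) u"
  shows "order_ideal L (A \<union> {u})"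
  unfolding order_ideal_def
proof (intro conjI ballI impI)
  have u: "u \<in> U" and min: "\<And>v. v \<in> U - A \<Longrightarrow> v \<sqsubseteq> u \<Longrightarrow> v = u"
    using assms(3) by (auto simp: minimal_elem_def lless_iff)
  show "A \<union> {u} \<subseteq> carrier L" using assms(1,2) u by (auto simp: order_ideal_def)
  fix x y assume x: "x \<in> A \<union> {u}" and y: "y \<in> carrier L" "y \<sqsubseteq> x"
  show "y \<in> A \<union> {u}"
  proof (cases "x = u")
    case True
    then have "y \<in> U" using assms(2) u y by (auto simp: order_ideal_def)
    then show ?thesis using min[of y] y True by auto
  qed (use x y assms(1) in \<open>auto simp: order_ideal_def\<close>)
qed

text \<open>An element of \<open>A\<close> strictly above \<open>u\<close> would lie in \<open>W\<close> by maximality, and then so would \<open>u\<close>,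
  because \<open>W\<close> is down-closed.\<close>

lemma order_ideal_remove_maximal:
  assumes "order_ideal L A" "order_ideal L W" "maximal_elem L (A - W) u"
  shows "order_ideal L (A - {u})"
  unfolding order_ideal_def
proof (intro conjI ballI impI)
  have u: "u \<in> A" "u \<notin> W" and max: "\<And>v. v \<in> A - W \<Longrightarrow> u \<sqsubseteq> v \<Longrightarrow> v = u"
    using assms(3) by (auto simp: maximal_elem_def lless_iff)
  show "A - {u} \<subseteq> carrier L" using assms(1) by (auto simp: order_ideal_def)
  fix x y assume x: "x \<in> A - {u}" and y: "y \<in> carrier L" "y \<sqsubseteq> x"
  have "x \<in> W" if "y = u" using max[of x] x y that by auto
  then have "y \<noteq> u" using assms(2) u(2) y by (auto simp: order_ideal_def)
  then show "y \<in> A - {u}" using assms(1) x y by (auto simp: order_ideal_def)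
qed

lemma adds_minimal_run:
  assumes fin: "finite (carrier L)" and ideals: "order_ideal L S" "order_ideal L U" and sub: "S \<subseteq> U"
    and run: "fwd_run (adds_minimal L U) S n X" and j: "j \<le> n"
  shows "order_ideal L (X j) \<and> S \<subseteq> X j \<and> X j \<subseteq> U \<and> card (X j) = card S + j"
  using j
proof (induction j)
  case 0
  then show ?case using run ideals sub by (simp add: fwd_run_def)
next
  case (Suc j)
  then have IH: "order_ideal L (X j)" "S \<subseteq> X j" "X j \<subseteq> U" "card (X j) = card S + j" by auto
  have "adds_minimal L U (X j) (X (Suc j))" using fwd_run_step[OF run] Suc.prems by simp
  then obtain u where u: "minimal_elem L (U - X j) u" and X: "X (Suc j) = X j \<union> {u}"
    unfolding adds_minimal_def by blast
  have "finite (X j)"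
    using IH(1) fin by (auto simp: order_ideal_def intro: finite_subset)
  moreover have "u \<in> U" "u \<notin> X j" using u by (auto simp: minimal_elem_def)
  ultimately show ?case
    using IH order_ideal_add_minimal[OF IH(1) ideals(2) u] unfolding X by auto
qed

lemma removes_maximal_run:
  assumes fin: "finite (carrier L)" and ideals: "order_ideal L S" "order_ideal L W" and sub: "W \<subseteq> S"
    and run: "fwd_run (removes_maximal L W) S n X" and j: "j \<le> n"
  shows "order_ideal L (X j) \<and> W \<subseteq> X j \<and> X j \<subseteq> S \<and> card (X j) + j = card S"
  using j
proof (induction j)
  case 0
  then show ?case using run ideals sub by (simp add: fwd_run_def)
next
  case (Suc j)
  then have IH: "order_ideal L (X j)" "W \<subseteq> X j" "X j \<subseteq> S" "card (X j) + j = card S" by auto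
  have "removes_maximal L W (X j) (X (Suc j))" using fwd_run_step[OF run] Suc.prems by simp
  then obtain u where u: "maximal_elem L (X j - W) u" and X: "X (Suc j) = X j - {u}"
    unfolding removes_maximal_def by blast
  have f: "finite (X j)"
    using IH(1) fin by (auto simp: order_ideal_def intro: finite_subset)
  have "u \<in> X j" "u \<notin> W" using u by (auto simp: maximal_elem_def)
  moreover from this have "Suc (card (X j - {u})) = card (X j)"
    using f by (simp only: card_Suc_Diff1)
  ultimately show ?case
    using IH order_ideal_remove_maximal[OF IH(1) ideals(2) u] unfolding X by auto
qed

end

definition ideal_step :: "'a set \<Rightarrow> 'a set \<Rightarrow> bool" where
  "ideal_step A B \<longleftrightarrow> (\<exists>u. u \<notin> A \<and> B = insert u A)"

lemma adds_minimal_step: "adds_minimal P U A B \<Longrightarrow> ideal_step A B"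
  by (auto simp: adds_minimal_def minimal_elem_def ideal_step_def)

lemma removes_maximal_step: "removes_maximal P W A B \<Longrightarrow> ideal_step B A"
  by (auto simp: removes_maximal_def maximal_elem_def ideal_step_def)

text \<open>Reading the indices downwards turns the second phase of a construction into a first phase that
  starts at \<open>T\<close>, so that one analysis serves both phases.\<close>

lemma bwd_run_imp_fwd_run:
  assumes "bwd_run R T a b n X" "n \<le> b"
  shows "fwd_run R T (b - n) (\<lambda>k. X (a + b - k))"
  unfolding fwd_run_def
proof (intro conjI ballI)
  show "X (a + b - 0) = T" using assms by (simp add: bwd_run_def)
  fix k assume k: "k \<in> {1..b - n}"
  then have "b - k + 1 \<in> {n + 1..b}" using assms(2) by auto
  then have "R (X (a + (b - k + 1))) (X (a + (b - k + 1) - 1))"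
    using assms(1) unfolding bwd_run_def by blast
  moreover have "a + (b - k + 1) = a + b - (k - 1)" "a + (b - k + 1) - 1 = a + b - k"
    using k assms(2) by auto
  ultimately show "R (X (a + b - (k - 1))) (X (a + b - k))" by (simp only:)
qed

section \<open>Semimodularity and rank\<close>

locale modular_order_diagram = lattice L for L :: "('a, 'm) gorder_scheme" (structure) +
  fixes G :: "'a pair_pre_digraph" and col :: "'a \<times> 'a \<Rightarrow> 'i" and \<rho> :: "'a \<Rightarrow> nat"
  assumes modular: "modular_lattice L"
    and finite_carrier: "finite (carrier L)"
    and diagram: "is_order_diagram G L"
    and diamond: "diamond_colored G col"
    and rank: "is_rank_function L \<rho>"
begin

lemma arc_iff: "(x, y) \<in> parcs G \<longleftrightarrow> covers L y x"
  using diagram by (simp add: is_order_diagram_def)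

lemma pverts_eq: "pverts G = carrier L"
  using diagram by (simp add: is_order_diagram_def)

lemma modular_law:
  assumes "x \<in> carrier L" "y \<in> carrier L" "z \<in> carrier L" "x \<sqsubseteq> z"
  shows "x \<squnion> (y \<sqinter> z) = (x \<squnion> y) \<sqinter> z"
  using modular assms by (simp add: modular_lattice_def)

lemma rank_covers: "covers L y x \<Longrightarrow> \<rho> y = \<rho> x + 1"
  using rank by (simp add: is_rank_function_def)

text \<open>By the modular law, meeting with \<open>y\<close> sends any element strictly between \<open>w\<close> and \<open>y \<squnion> w\<close> to one
  strictly between \<open>x\<close> and \<open>y\<close>, and there is none.\<close>

lemma cover_join:
  assumes c: "covers L y x" and w: "w \<in> carrier L" and le: "x \<sqsubseteq> w" and nle: "\<not> y \<sqsubseteq> w"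
  shows "covers L (y \<squnion> w) w"
proof (rule coversI)
  note cD = coversD[OF c]
  show "w \<in> carrier L" "y \<squnion> w \<in> carrier L" "w \<sqsubseteq> y \<squnion> w"
    using w cD by (auto intro: join_right)
  show "w \<noteq> y \<squnion> w" using nle join_left[of y w] w cD by auto
  fix z assume z: "z \<in> carrier L" "w \<sqsubseteq> z" "z \<sqsubseteq> y \<squnion> w"
  have "x \<sqsubseteq> y \<sqinter> z" using le_trans[OF le z(2)] cD w z(1) by (auto intro: meet_le)
  then have "y \<sqinter> z = x \<or> y \<sqinter> z = y"
    using covers_between[OF c, of "y \<sqinter> z"] cD z(1) meet_left[of y z] by simp
  then show "z = w \<or> z = y \<squnion> w"
  proof
    assume "y \<sqinter> z = x"
    then have "w \<squnion> x = (w \<squnion> y) \<sqinter> z" using modular_law[OF w cD(2) z(1,2)] by simp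
    moreover have "w \<squnion> x = w"
      using le_iff_meet[of x w] join_comm[of L w x] cD w le by simp
    moreover have "(w \<squnion> y) \<sqinter> z = z"
      using le_iff_join[of z "y \<squnion> w"] z cD w join_comm[of L w y] meet_comm[of L z] by simp
    ultimately show ?thesis by simp
  next
    assume "y \<sqinter> z = y"
    then have "y \<sqsubseteq> z" using meet_right[of y z] cD z by simp
    then have "y \<squnion> w \<sqsubseteq> z" using cD w z by (auto intro: join_le)
    then show ?thesis using z cD w by (auto intro: le_antisym)
  qed
qed

text \<open>Two distinct covers of \<open>x\<close> always span a diamond; this is how the diamond coloring is exploited.\<close>

lemma diamond_colors:
  assumes "covers L a x" "covers L b x" "a \<noteq> b"
  shows "covers L (a \<squnion> b) a" "covers L (a \<squnion> b) b"
    and "col (x, a) = col (b, a \<squnion> b)" "col (x, b) = col (a, a \<squnion> b)"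
proof -
  have "\<not> a \<sqsubseteq> b" "\<not> b \<sqsubseteq> a"
    using assms(3) covers_between[OF assms(1), of b] covers_between[OF assms(2), of a]
      coversD[OF assms(1)] coversD[OF assms(2)] by auto
  then show c: "covers L (a \<squnion> b) a" "covers L (a \<squnion> b) b"
    using cover_join[OF assms(1), of b] cover_join[OF assms(2), of a]
      coversD[OF assms(1)] coversD[OF assms(2)] by (simp_all add: join_comm[of L b a])
  show "col (x, a) = col (b, a \<squnion> b)" "col (x, b) = col (a, a \<squnion> b)"
    using diamond[unfolded diamond_colored_def arc_iff, rule_format, of a x b "a \<squnion> b"] assms c
    by simp_all
qed

lemma rank_mono:
  assumes "x \<in> carrier L" "y \<in> carrier L" "x \<sqsubseteq> y"
  shows "\<rho> x \<le> \<rho> y"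
  using finite_carrier assms by (induction rule: le_cover_induct) (auto dest: rank_covers)

lemma rank_strict_mono:
  assumes "x \<in> carrier L" "y \<in> carrier L" "x \<sqsubseteq> y" "x \<noteq> y"
  shows "\<rho> x < \<rho> y"
proof -
  obtain z where "covers L z x" "z \<sqsubseteq> y" using ex_cover_above finite_carrier assms by blast
  then show ?thesis using rank_mono[of z y] rank_covers[of z x] coversD(2)[of z x] assms(2) by simp
qed

text \<open>As \<open>a\<close> climbs from \<open>x \<sqinter> y\<close> to \<open>x\<close> along covers, \<open>a \<squnion> y\<close> climbs from \<open>y\<close> to \<open>x \<squnion> y\<close>, and the
  modular law prevents it from standing still, so both ranks grow by the same amount.\<close>

lemma rank_meet_join:
  assumes x: "x \<in> carrier L" and y: "y \<in> carrier L"
  shows "\<rho> (x \<squnion> y) + \<rho> (x \<sqinter> y) = \<rho> x + \<rho> y"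
proof -
  have "a \<sqsubseteq> x \<longrightarrow> \<rho> (a \<squnion> y) + \<rho> (x \<sqinter> y) = \<rho> a + \<rho> y"
    if "a \<in> carrier L" "x \<sqinter> y \<sqsubseteq> a" for a
    using finite_carrier meet_closed[OF x y] that
  proof (induction rule: le_cover_induct)
    case base
    have "(x \<sqinter> y) \<squnion> y = y" using le_iff_meet[of "x \<sqinter> y" y] x y by (simp add: meet_right)
    then show ?case by simp
  next
    case (step b a)
    note cD = coversD[OF step(3)]
    show ?case
    proof
      assume bx: "b \<sqsubseteq> x"
      then have "a \<sqsubseteq> x" using le_trans cD x by blast
      with step have IH: "\<rho> (a \<squnion> y) + \<rho> (x \<sqinter> y) = \<rho> a + \<rho> y" by blast
      \<comment> \<open>If the join stood still, the modular law would give \<open>b = a \<squnion> (y \<sqinter> b) \<sqsubseteq> a\<close>.\<close>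
      have nle: "\<not> b \<sqsubseteq> a \<squnion> y"
      proof
        assume "b \<sqsubseteq> a \<squnion> y"
        then have "b = (a \<squnion> y) \<sqinter> b"
          using le_iff_join[of b "a \<squnion> y"] cD y meet_comm[of L b] by simp
        also have "\<dots> = a \<squnion> (y \<sqinter> b)" using modular_law cD y by simp
        also have "\<dots> \<sqsubseteq> a"
        proof -
          have "y \<sqinter> b \<sqsubseteq> x" using le_trans[OF meet_right[of y b] bx] cD x y by simp
          then have "y \<sqinter> b \<sqsubseteq> x \<sqinter> y" using cD x y by (auto intro: meet_le meet_left)
          then have "y \<sqinter> b \<sqsubseteq> a" using le_trans[OF _ step(2)] cD x y by simp
          then show ?thesis using cD y by (auto intro: join_le)
        qed
        finally show False using cD by simp
      qed
      have "covers L (b \<squnion> (a \<squnion> y)) (a \<squnion> y)"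
        using cover_join[OF step(3) _ _ nle] cD y by (auto intro: join_left)
      moreover have "b \<squnion> (a \<squnion> y) = b \<squnion> y"
        using weak_join_assoc[of b a y] le_iff_meet[of a b] join_comm[of L b a] cD y
        by (simp add: eq_is_equal)
      ultimately have "\<rho> (b \<squnion> y) = \<rho> (a \<squnion> y) + 1" using rank_covers by metis
      then show "\<rho> (b \<squnion> y) + \<rho> (x \<sqinter> y) = \<rho> b + \<rho> y"
        using IH rank_covers[OF step(3)] by simp
    qed
  qed
  from this[OF x] show ?thesis using x y meet_left by simp
qed

end

section \<open>Colors along saturated chains\<close>

text \<open>The colors are collected in a multiset, because the order in which they occur is not determined
  by the ends of the chain. Its size is the length of the chain.\<close>

inductive saturated_chain ::
    "('a, 'm) gorder_scheme \<Rightarrow> ('a \<times> 'a \<Rightarrow> 'i) \<Rightarrow> 'a \<Rightarrow> 'a \<Rightarrow> 'i multiset \<Rightarrow> bool"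
  for L col where
  refl: "x \<in> carrier L \<Longrightarrow> saturated_chain L col x x {#}"
| step: "covers L y x \<Longrightarrow> saturated_chain L col y z M \<Longrightarrow>
    saturated_chain L col x z (add_mset (col (x, y)) M)"

context modular_order_diagram
begin

abbreviation chain :: "'a \<Rightarrow> 'a \<Rightarrow> 'i multiset \<Rightarrow> bool" where
  "chain \<equiv> saturated_chain L col"

lemma chainD:
  assumes "chain x y M"
  shows "x \<in> carrier L" "y \<in> carrier L" "x \<sqsubseteq> y" "\<rho> y = \<rho> x + size M"
proof -
  have "x \<in> carrier L \<and> y \<in> carrier L \<and> x \<sqsubseteq> y \<and> \<rho> y = \<rho> x + size M"
    using assms
  proof induction
    case (step y x z M)
    then show ?case using coversD[OF step(1)] rank_covers[OF step(1)] le_trans[of x y z] by simp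
  qed simp
  then show "x \<in> carrier L" "y \<in> carrier L" "x \<sqsubseteq> y" "\<rho> y = \<rho> x + size M" by simp_all
qed

lemma chain_trans:
  assumes "chain x y M" "chain y z N"
  shows "chain x z (M + N)"
  using assms by induction (auto intro: saturated_chain.step)

lemma chain_cover:
  assumes "covers L y x"
  shows "chain x y {#col (x, y)#}"
  using saturated_chain.step[OF assms saturated_chain.refl] coversD(2)[OF assms] by simp

lemma ex_chain:
  assumes "x \<in> carrier L" "y \<in> carrier L" "x \<sqsubseteq> y"
  shows "\<exists>M. chain x y M"
  using finite_carrier assms
proof (induction rule: le_cover_induct)
  case base
  show ?case by (rule exI, rule saturated_chain.refl) (rule assms(1))
next
  case (step y z)
  then show ?case using chain_trans chain_cover by blast
qed

lemma chain_refl_iff: "chain x x M \<longleftrightarrow> x \<in> carrier L \<and> M = {#}"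
  using chainD[of x x M] saturated_chain.refl[of x L col] by auto

text \<open>The argument of the Jordan-Hoelder theorem. If the chains start with different edges to \<open>a\<close> and \<open>b\<close>, compare both
  with chains through \<open>a \<squnion> b\<close>, which share everything above \<open>a \<squnion> b\<close>; below it, the two sides of
  the diamond carry the same two colors.\<close>

lemma chain_unique:
  assumes "chain x y M" "chain x y N"
  shows "M = N"
  using assms
proof (induction "\<rho> y - \<rho> x" arbitrary: x M N rule: less_induct)
  case less
  show ?case
  proof (cases "x = y")
    case True
    then show ?thesis using less.prems by (simp add: chain_refl_iff)
  next
    case False
    obtain a M' where a: "covers L a x" "chain a y M'" "M = add_mset (col (x, a)) M'"
      using less.prems(1) False by (auto elim: saturated_chain.cases)
    obtain b N' where b: "covers L b x" "chain b y N'" "N = add_mset (col (x, b)) N'"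
      using less.prems(2) False by (auto elim: saturated_chain.cases)
    have smaller: "\<rho> y - \<rho> a < \<rho> y - \<rho> x" "\<rho> y - \<rho> b < \<rho> y - \<rho> x"
      using rank_covers[OF a(1)] rank_covers[OF b(1)] chainD(4)[OF a(2)] chainD(4)[OF b(2)]
      by simp_all
    show ?thesis
    proof (cases "a = b")
      case True
      then show ?thesis using less.hyps[OF smaller(1) a(2)] a b by simp
    next
      case False
      note d = diamond_colors[OF a(1) b(1) False]
      have "a \<squnion> b \<sqsubseteq> y"
        using chainD[OF a(2)] chainD[OF b(2)] by (auto intro: join_le)
      then obtain K where K: "chain (a \<squnion> b) y K"
        using ex_chain[of "a \<squnion> b" y] chainD[OF a(2)] chainD[OF b(2)] by auto
      have "M' = add_mset (col (a, a \<squnion> b)) K"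
        using less.hyps[OF smaller(1) a(2)] saturated_chain.step[OF d(1) K] by blast
      moreover have "N' = add_mset (col (b, a \<squnion> b)) K"
        using less.hyps[OF smaller(2) b(2)] saturated_chain.step[OF d(2) K] by blast
      ultimately show ?thesis using a(3) b(3) d(3,4) by simp
    qed
  qed
qed

text \<open>The chain and its join with \<open>y\<close> are the two long sides of a ladder of diamonds. Going up the
  ladder, the colors of the rungs agree, and so do those of the two sides.\<close>

lemma chain_transport:
  assumes "chain x w M" "covers L y x" "\<not> y \<sqsubseteq> w"
  shows "covers L (y \<squnion> w) w" "col (x, y) = col (w, y \<squnion> w)" "chain y (y \<squnion> w) M"
proof -
  have "covers L (y \<squnion> w) w \<and> col (x, y) = col (w, y \<squnion> w) \<and> chain y (y \<squnion> w) M"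
    using assms
  proof (induction arbitrary: y)
    case (refl x)
    have "y \<squnion> x = y"
      using le_iff_meet[of x y] join_comm[of L x y] coversD[OF refl(2)] by simp
    then show ?case using refl saturated_chain.refl[of y L col] coversD(2)[OF refl(2)] by simp
  next
    case (step a x w M)
    note aD = coversD[OF step(1)] and yD = coversD[OF step(4)] and wD = chainD[OF step(2)]
    have "y \<noteq> a" using wD step(5) by blast
    note d = diamond_colors[OF step(4,1) this]
    have "\<not> y \<squnion> a \<sqsubseteq> w"
      using le_trans[OF join_left[of y a], of w] step(5) aD yD wD by auto
    note IH = step.IH[OF d(2) this]
    have eq: "y \<squnion> a \<squnion> w = y \<squnion> w"
      using weak_join_assoc[of y a w] le_iff_meet[of a w] aD yD wD by (simp add: eq_is_equal)
    then have "chain (y \<squnion> a) (y \<squnion> w) M" using IH by simp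
    then have "chain y (y \<squnion> w) (add_mset (col (x, a)) M)"
      unfolding d(4) by (rule saturated_chain.step[OF d(1)])
    then show ?case using IH eq d(3) by simp
  qed
  then show "covers L (y \<squnion> w) w" "col (x, y) = col (w, y \<squnion> w)" "chain y (y \<squnion> w) M"
    by simp_all
qed

end

section \<open>Shortest paths in a modular lattice\<close>

lemma path_length_Cons_Cons: "path_length (x # y # p) = Suc (path_length (y # p))"
  by (simp add: path_length_def)

lemma is_path_Cons_Cons:
  "is_path G s (x # y # p) t \<longleftrightarrow>
     x = s \<and> s \<in> pverts G \<and> ((s, y) \<in> parcs G \<or> (y, s) \<in> parcs G) \<and> is_path G y (y # p) t"
  by (auto simp: is_path_def)

lemma is_path_singleton: "is_path G s [x] t \<longleftrightarrow> x = s \<and> s = t \<and> s \<in> pverts G"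
  by (auto simp: is_path_def)

lemma is_path_Nil: "\<not> is_path G s [] t"
  by (simp add: is_path_def)

lemmas is_path_simps = is_path_Nil is_path_singleton is_path_Cons_Cons

lemma is_path_Cons_hd: "is_path G s (x # p) t \<Longrightarrow> x = s"
  by (simp add: is_path_def)

lemma color_count_singleton: "color_count G col i [x] = 0"
  by (simp add: color_count_def path_length_def)

lemma color_count_Cons_Cons:
  "color_count G col i (x # y # p) =
     (if step_color G col x y = i then 1 else 0) + color_count G col i (y # p)"
proof -
  let ?J = "{j. j < path_length (y # p) \<and> step_color G col ((y # p) ! j) ((y # p) ! Suc j) = i}"
  let ?A = "{j. j < path_length (x # y # p) \<and>
              step_color G col ((x # y # p) ! j) ((x # y # p) ! Suc j) = i}"
  have "j \<in> ?A \<longleftrightarrow> j \<in> (if step_color G col x y = i then {0} else {}) \<union> Suc ` ?J" for j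
    by (cases j) (auto simp: path_length_def)
  then have "?A = (if step_color G col x y = i then {0} else {}) \<union> Suc ` ?J" by blast
  moreover have "card (Suc ` ?J) = card ?J" by (simp add: card_image)
  moreover have "finite (Suc ` ?J)" "0 \<notin> Suc ` ?J" by auto
  ultimately show ?thesis unfolding color_count_def by simp
qed

context modular_order_diagram
begin

lemma join_cover_step:
  assumes c: "covers L y x" and t: "t \<in> carrier L"
  shows "y \<squnion> t = x \<squnion> t \<or> covers L (y \<squnion> t) (x \<squnion> t)"
proof -
  note cD = coversD[OF c]
  have eq: "y \<squnion> (x \<squnion> t) = y \<squnion> t"
    using weak_join_assoc[of y x t] le_iff_meet[of x y] join_comm[of L y x] cD t
    by (simp add: eq_is_equal)
  show ?thesis
  proof (cases "y \<sqsubseteq> x \<squnion> t")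
    case True
    then show ?thesis using eq le_iff_meet[of y "x \<squnion> t"] cD t by simp
  next
    case False
    then show ?thesis using cover_join[OF c, of "x \<squnion> t"] eq cD t join_left[of x t] by simp
  qed
qed

lemma rank_join_cover:
  assumes "covers L y x" "t \<in> carrier L"
  shows "\<rho> (x \<squnion> t) \<le> \<rho> (y \<squnion> t)" "\<rho> (y \<squnion> t) \<le> \<rho> (x \<squnion> t) + 1"
  using join_cover_step[OF assms] rank_covers[of "y \<squnion> t" "x \<squnion> t"] by auto

text \<open>The first edge of the path changes \<open>\<rho> s\<close> by one, and when it goes down it can lower
  \<open>\<rho> (s \<squnion> t)\<close> by at most one, so \<open>2 * \<rho> (s \<squnion> t) - \<rho> s\<close> drops by at most one.\<close>

lemma path_length_ge:
  assumes "is_path G s p t" "t \<in> carrier L"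
  shows "2 * \<rho> (s \<squnion> t) \<le> \<rho> s + \<rho> t + path_length p"
  using assms(1)
proof (induction p arbitrary: s rule: induct_list012)
  case (2 x)
  then show ?case using le_iff_meet[of t t] assms(2) by (simp add: is_path_simps)
next
  case (3 x y p)
  then have s: "s \<in> carrier L" and e: "covers L y s \<or> covers L s y"
    and IH: "2 * \<rho> (y \<squnion> t) \<le> \<rho> y + \<rho> t + path_length (y # p)"
    by (auto simp: is_path_simps arc_iff pverts_eq)
  have "\<rho> y = \<rho> s + 1 \<and> \<rho> (s \<squnion> t) \<le> \<rho> (y \<squnion> t) \<or>
        \<rho> s = \<rho> y + 1 \<and> \<rho> (s \<squnion> t) \<le> \<rho> (y \<squnion> t) + 1"
    using e
  proof
    assume "covers L y s"
    then show ?thesis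
      using rank_covers[of y s] rank_join_cover[of y s t] assms(2) by simp
  next
    assume "covers L s y"
    then show ?thesis
      using rank_covers[of s y] rank_join_cover[of s y t] assms(2) by simp
  qed
  then show ?case using IH unfolding path_length_Cons_Cons by linarith
qed (simp add: is_path_simps)

text \<open>A step that lowers \<open>2 * \<rho> (s \<squnion> t) - \<rho> s - \<rho> t\<close> exists unless \<open>s = t\<close>: a step up
  towards \<open>s \<squnion> t\<close> as long as \<open>t\<close> is not below \<open>s\<close>, afterwards a step down towards \<open>t\<close>.\<close>

lemma ex_path:
  assumes "s \<in> carrier L" "t \<in> carrier L"
  shows "\<exists>p. is_path G s p t \<and> \<rho> s + \<rho> t + path_length p = 2 * \<rho> (s \<squnion> t)"
  using assms(1)
proof (induction "2 * \<rho> (s \<squnion> t) - \<rho> s" arbitrary: s rule: less_induct)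
  case less
  note t = assms(2) and s = less.prems
  \<comment> \<open>The hypothesis \<open>d\<close> says that the step from \<open>s\<close> to \<open>s'\<close> brings the path one closer to \<open>t\<close>.\<close>
  have extend: ?case
    if e: "covers L s' s \<or> covers L s s'"
      and d: "2 * \<rho> (s' \<squnion> t) + \<rho> s + 1 = 2 * \<rho> (s \<squnion> t) + \<rho> s'" for s'
  proof -
    have s': "s' \<in> carrier L" using e coversD by blast
    have "\<rho> s' \<le> \<rho> (s' \<squnion> t)" "\<rho> s \<le> \<rho> (s \<squnion> t)"
      using rank_mono join_left s s' t by simp_all
    then have "2 * \<rho> (s' \<squnion> t) - \<rho> s' < 2 * \<rho> (s \<squnion> t) - \<rho> s" using d by linarith
    then obtain p where p: "is_path G s' p t" "\<rho> s' + \<rho> t + path_length p = 2 * \<rho> (s' \<squnion> t)"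
      using less.hyps[of s'] s' by auto
    then obtain p' where "p = s' # p'"
      by (cases p) (auto simp: is_path_Nil dest: is_path_Cons_hd)
    then have "is_path G s (s # p) t" "path_length (s # p) = Suc (path_length p)"
      using p(1) e s by (auto simp: is_path_simps arc_iff pverts_eq path_length_Cons_Cons)
    then show ?thesis using p(2) d by (intro exI[of _ "s # p"]) simp
  qed
  consider "s = t" | "\<not> t \<sqsubseteq> s" | "t \<sqsubseteq> s" "s \<noteq> t" by blast
  then show ?case
  proof cases
    case 1
    then have "s \<squnion> t = t" using le_iff_meet[of t t] t by simp
    then show ?thesis using 1 t
      by (intro exI[of _ "[t]"]) (simp add: is_path_simps pverts_eq path_length_def)
  next
    case 2
    have "s \<noteq> s \<squnion> t" using join_right[of s t] s t 2 by auto
    then obtain s' where s': "covers L s' s" "s' \<sqsubseteq> s \<squnion> t"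
      using ex_cover_above[OF finite_carrier, of s "s \<squnion> t"] s t join_left by auto
    have "s' \<squnion> t \<sqsubseteq> s \<squnion> t" using s' coversD(2) s t join_right by (auto intro: join_le)
    then have "\<rho> (s' \<squnion> t) \<le> \<rho> (s \<squnion> t)" using rank_mono coversD(2)[OF s'(1)] s t by simp
    then have "s' \<squnion> t = s \<squnion> t"
      using join_cover_step[OF s'(1) t] rank_covers[of "s' \<squnion> t" "s \<squnion> t"] by auto
    then show ?thesis using extend[of s'] s' rank_covers[OF s'(1)] by simp
  next
    case 3
    then obtain s' where s': "covers L s s'" "t \<sqsubseteq> s'"
      using ex_cover_below[OF finite_carrier, of t s] s t by auto
    have "s \<squnion> t = s" "s' \<squnion> t = s'"
      using le_iff_meet[of t s] le_iff_meet[of t s'] join_comm[of L t s] join_comm[of L t s']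
        3 s' coversD(1)[OF s'(1)] s t by simp_all
    then show ?thesis using extend[of s'] s' rank_covers[OF s'(1)] by simp
  qed
qed

lemma path_distance_join:
  assumes "s \<in> carrier L" "t \<in> carrier L"
  shows "\<rho> s + \<rho> t + path_distance G s t = 2 * \<rho> (s \<squnion> t)"
proof -
  obtain p where p: "is_path G s p t" "\<rho> s + \<rho> t + path_length p = 2 * \<rho> (s \<squnion> t)"
    using ex_path assms by blast
  have "path_distance G s t = path_length p"
    unfolding path_distance_def
    using p path_length_ge[OF _ assms(2)] by (intro Least_equality) (blast, fastforce)
  then show ?thesis using p by simp
qed

lemma shortest_path_iff:
  assumes "s \<in> carrier L" "t \<in> carrier L"
  shows "shortest_path G s p t \<longleftrightarrow>
    is_path G s p t \<and> \<rho> s + \<rho> t + path_length p = 2 * \<rho> (s \<squnion> t)"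
  using path_distance_join[OF assms] by (auto simp: shortest_path_def)

text \<open>Since the path is shortest, its first edge brings it closer to \<open>t\<close>. An edge up to \<open>y\<close>
  leaves the join with \<open>t\<close> unchanged and is then the bottom edge of a chain from \<open>s\<close> to that join. An
  edge down to \<open>y\<close> lowers the join by a cover, which has the color of that edge, and the chain from
  \<open>y\<close> to \<open>y \<squnion> t\<close> has the colors of the chain from \<open>s\<close> to \<open>s \<squnion> t\<close>: both by transport.\<close>

lemma color_count_shortest_path:
  assumes "is_path G s p t" "\<rho> s + \<rho> t + path_length p = 2 * \<rho> (s \<squnion> t)" "t \<in> carrier L"
    and "chain s (s \<squnion> t) M" "chain t (s \<squnion> t) N"
  shows "color_count G col i p = count (M + N) i"
  using assms(1,2,4,5)
proof (induction p arbitrary: s M N rule: induct_list012)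
  case (2 x)
  then have st: "s = t" "x = t" by (simp_all add: is_path_simps)
  have "t \<squnion> t = t" using le_iff_meet[of t t] assms(3) by simp
  then show ?case using 2(3,4) unfolding st by (simp add: chain_refl_iff color_count_singleton)
next
  case (3 x y p)
  note t = assms(3)
  have x: "x = s" and s: "s \<in> carrier L" and e: "covers L y s \<or> covers L s y"
    and path: "is_path G y (y # p) t"
    using 3(3) by (auto simp: is_path_simps arc_iff pverts_eq)
  have len: "\<rho> s + \<rho> t + path_length (y # p) + 1 = 2 * \<rho> (s \<squnion> t)"
    using 3(4) by (simp add: path_length_Cons_Cons)
  note ge = path_length_ge[OF path t]
  from e show ?case
  proof
    assume c: "covers L y s"
    note cD = coversD[OF c]
    have "\<rho> (y \<squnion> t) = \<rho> (s \<squnion> t)"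
      using ge len rank_covers[OF c] join_cover_step[OF c t] rank_covers[of "y \<squnion> t" "s \<squnion> t"]
      by auto
    then have eq: "y \<squnion> t = s \<squnion> t"
      using join_cover_step[OF c t] rank_covers[of "y \<squnion> t" "s \<squnion> t"] by auto
    obtain K where K: "chain y (y \<squnion> t) K" using ex_chain[of y "y \<squnion> t"] cD t join_left by auto
    have "M = add_mset (col (s, y)) K"
      using chain_unique[OF 3(5)] saturated_chain.step[OF c K] eq by simp
    moreover have "color_count G col i (y # p) = count (K + N) i"
      using "3.IH"(2)[OF path _ K] 3(6) eq len rank_covers[OF c] by simp
    moreover have "step_color G col x y = col (s, y)"
      using c x by (simp add: step_color_def arc_iff)
    ultimately show ?thesis by (simp add: color_count_Cons_Cons)
  next
    assume c: "covers L s y"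
    note cD = coversD[OF c]
    have "y \<squnion> t \<noteq> s \<squnion> t" using ge len rank_covers[OF c] by auto
    then have c': "covers L (s \<squnion> t) (y \<squnion> t)" using join_cover_step[OF c t] by auto
    obtain K where K: "chain y (y \<squnion> t) K" using ex_chain[of y "y \<squnion> t"] cD t join_left by auto
    obtain N' where N': "chain t (y \<squnion> t) N'" using ex_chain[of t "y \<squnion> t"] cD t join_right by auto
    have eq: "s \<squnion> (y \<squnion> t) = s \<squnion> t"
      using weak_join_assoc[of s y t] le_iff_meet[of y s] join_comm[of L s y] cD t
      by (simp add: eq_is_equal)
    have nle: "\<not> s \<sqsubseteq> y \<squnion> t"
      using eq le_iff_meet[of s "y \<squnion> t"] cD t \<open>y \<squnion> t \<noteq> s \<squnion> t\<close> by simp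
    note tr = chain_transport[OF K c nle, unfolded eq]
    have "M = K" using chain_unique[OF 3(5) tr(3)] .
    moreover have "N = add_mset (col (y \<squnion> t, s \<squnion> t)) N'"
      using chain_unique[OF 3(6) chain_trans[OF N' chain_cover[OF c']]] by simp
    moreover have "color_count G col i (y # p) = count (K + N') i"
      using "3.IH"(2)[OF path _ K N'] len rank_covers[OF c] rank_covers[OF c'] by simp
    moreover have "step_color G col x y = col (y, s)"
      using c x cD coversD(5)[of y s] by (auto simp: step_color_def arc_iff)
    ultimately show ?thesis using tr(2) by (simp add: color_count_Cons_Cons)
  qed
qed (simp add: is_path_simps)

end

section \<open>Order ideals of join irreducibles\<close>

context partial_order
begin

lemma partial_order_j_poset: "partial_order (j_poset L)"
proof -
  interpret J: weak_partial_order "j_poset L"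
    unfolding j_poset_def
    by (rule weak_partial_order_subset) (unfold_locales, auto simp: join_irreducible_def)
  show ?thesis by unfold_locales (simp add: j_poset_def eq_is_equal)
qed

lemma j_poset_simps:
  "carrier (j_poset L) = {x. join_irreducible L x}" "x \<sqsubseteq>\<^bsub>j_poset L\<^esub> y \<longleftrightarrow> x \<sqsubseteq> y"
  by (simp_all add: j_poset_def)

lemma ideal_of_eq: "ideal_of L s = {p. join_irreducible L p \<and> p \<sqsubseteq> s}"
  by (simp add: ideal_of_def j_poset_simps)

lemma join_irreducible_carrier: "join_irreducible L p \<Longrightarrow> p \<in> carrier L"
  by (simp add: join_irreducible_def)

lemma order_ideal_ideal_of:
  assumes "s \<in> carrier L"
  shows "order_ideal (j_poset L) (ideal_of L s)"
  unfolding order_ideal_def j_poset_simps ideal_of_eq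
proof (intro conjI ballI impI)
  fix x y assume "x \<in> {p. join_irreducible L p \<and> p \<sqsubseteq> s}" "y \<in> {x. join_irreducible L x}" "y \<sqsubseteq> x"
  then show "y \<in> {p. join_irreducible L p \<and> p \<sqsubseteq> s}"
    using le_trans[of y x s] join_irreducible_carrier assms by auto
qed auto

end

locale distributive_order_diagram = modular_order_diagram +
  assumes distributive: "distributive_lattice L"
begin

abbreviation ideal :: "'a \<Rightarrow> 'a set" where
  "ideal \<equiv> ideal_of L"

lemma finite_ideal: "finite (ideal s)"
  using finite_subset[OF _ finite_carrier, of "ideal s"] join_irreducible_carrier
  by (auto simp: ideal_of_eq)

lemma ideal_mono:
  assumes "x \<in> carrier L" "y \<in> carrier L" "x \<sqsubseteq> y"
  shows "ideal x \<subseteq> ideal y"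
  using assms le_trans[of _ x y] join_irreducible_carrier by (auto simp: ideal_of_eq)

text \<open>A minimal element \<open>v\<close> among those below \<open>y\<close> but not below \<open>x\<close> works: everything strictly below
  \<open>v\<close> is below \<open>x\<close>, so \<open>v \<sqinter> x\<close> is the only element that \<open>v\<close> covers.\<close>

lemma ex_separating_join_irreducible:
  assumes x: "x \<in> carrier L" and y: "y \<in> carrier L" and "\<not> y \<sqsubseteq> x"
  shows "\<exists>v. join_irreducible L v \<and> covers L v (v \<sqinter> x) \<and> v \<sqsubseteq> y \<and> \<not> v \<sqsubseteq> x \<and>
    (\<forall>z\<in>carrier L. z \<sqsubseteq> v \<longrightarrow> z \<noteq> v \<longrightarrow> z \<sqsubseteq> x)"
proof -
  let ?A = "{v \<in> carrier L. v \<sqsubseteq> y \<and> \<not> v \<sqsubseteq> x}"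
  have "y \<in> ?A" using assms by simp
  then obtain v where "minimal_elem L ?A v"
    using ex_minimal_elem[of ?A] finite_carrier by auto
  then have v: "v \<in> carrier L" "v \<sqsubseteq> y" "\<not> v \<sqsubseteq> x"
    and min: "\<And>z. z \<in> ?A \<Longrightarrow> z \<sqsubseteq> v \<Longrightarrow> z = v"
    by (auto simp: minimal_elem_def lless_iff)
  have below: "z \<sqsubseteq> x" if "z \<in> carrier L" "z \<sqsubseteq> v" "z \<noteq> v" for z
    using min[of z] that le_trans[of z v y] v y by auto
  have below_meet: "z \<sqsubseteq> v \<sqinter> x" if "z \<in> carrier L" "z \<sqsubseteq> v" "z \<noteq> v" for z
    using below[OF that] that v x by (auto intro: meet_le)
  have cov: "covers L v (v \<sqinter> x)"
  proof (rule coversI)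
    show "v \<sqinter> x \<noteq> v" using meet_right[of v x] v x by auto
    fix z assume z: "z \<in> carrier L" "v \<sqinter> x \<sqsubseteq> z" "z \<sqsubseteq> v"
    then show "z = v \<sqinter> x \<or> z = v"
      using below_meet[of z] le_antisym[of z "v \<sqinter> x"] v x by auto
  qed (use v x meet_left in auto)
  have "z = v \<sqinter> x" if c: "covers L v z" for z
    using covers_between[OF c, of "v \<sqinter> x"] below_meet[of z] coversD[OF c] coversD[OF cov] by auto
  then have "join_irreducible L v" using v(1) cov unfolding join_irreducible_def by blast
  then show ?thesis using v cov below by blast
qed

lemma ideal_subset_iff:
  assumes "x \<in> carrier L" "y \<in> carrier L"
  shows "ideal x \<subseteq> ideal y \<longleftrightarrow> x \<sqsubseteq> y"
proof
  assume "ideal x \<subseteq> ideal y"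
  then show "x \<sqsubseteq> y"
    using ex_separating_join_irreducible[OF assms(2,1)] unfolding ideal_of_eq by blast
qed (rule ideal_mono[OF assms])

text \<open>This is where distributivity enters. If \<open>p\<close> were below neither \<open>a\<close> nor \<open>b\<close>, both \<open>p \<sqinter> a\<close> and
  \<open>p \<sqinter> b\<close> would lie below the only element covered by \<open>p\<close>, and so would their join, which is \<open>p\<close>.\<close>

lemma join_irreducible_prime:
  assumes p: "join_irreducible L p" and a: "a \<in> carrier L" and b: "b \<in> carrier L"
    and le: "p \<sqsubseteq> a \<squnion> b"
  shows "p \<sqsubseteq> a \<or> p \<sqsubseteq> b"
proof (rule ccontr)
  assume neg: "\<not> (p \<sqsubseteq> a \<or> p \<sqsubseteq> b)"
  have pc: "p \<in> carrier L" using p by (rule join_irreducible_carrier)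
  obtain q where q: "covers L p q" "\<And>q'. covers L p q' \<Longrightarrow> q' = q"
    using p unfolding join_irreducible_def by blast
  have below: "c \<sqinter> p \<sqsubseteq> q" if c: "c \<in> carrier L" "\<not> p \<sqsubseteq> c" for c
  proof -
    have "c \<sqinter> p \<noteq> p" using c pc meet_left[of c p] by auto
    then obtain q' where "covers L p q'" "c \<sqinter> p \<sqsubseteq> q'"
      using ex_cover_below[OF finite_carrier, of "c \<sqinter> p" p] c pc meet_right by auto
    then show ?thesis using q(2) by blast
  qed
  have "p = p \<sqinter> (a \<squnion> b)" using le_iff_join[of p "a \<squnion> b"] le pc a b by simp
  also have "\<dots> = (p \<sqinter> a) \<squnion> (p \<sqinter> b)"
    using distributive pc a b by (simp add: distributive_lattice_def)
  also have "\<dots> \<sqsubseteq> q"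
    using below[of a] below[of b] neg a b pc coversD(1)[OF q(1)]
    by (intro join_le) (simp_all add: meet_comm[of L p])
  finally show False using coversD(5)[OF q(1)] by simp
qed

lemma ideal_join:
  assumes "x \<in> carrier L" "y \<in> carrier L"
  shows "ideal (x \<squnion> y) = ideal x \<union> ideal y"
proof
  show "ideal (x \<squnion> y) \<subseteq> ideal x \<union> ideal y"
    using join_irreducible_prime[OF _ assms] unfolding ideal_of_eq by blast
  show "ideal x \<union> ideal y \<subseteq> ideal (x \<squnion> y)"
    using ideal_mono[of x "x \<squnion> y"] ideal_mono[of y "x \<squnion> y"] assms join_left join_right by simp
qed

lemma ideal_meet:
  assumes "x \<in> carrier L" "y \<in> carrier L"
  shows "ideal (x \<sqinter> y) = ideal x \<inter> ideal y"
proof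
  show "ideal (x \<sqinter> y) \<subseteq> ideal x \<inter> ideal y"
    using ideal_mono[of "x \<sqinter> y" x] ideal_mono[of "x \<sqinter> y" y] assms meet_left meet_right by simp
  show "ideal x \<inter> ideal y \<subseteq> ideal (x \<sqinter> y)"
    using assms by (auto simp: ideal_of_eq join_irreducible_carrier intro: meet_le)
qed

text \<open>For the join irreducible \<open>v\<close> that separates \<open>y\<close> from \<open>x\<close>, the join \<open>v \<squnion> x\<close> is \<open>y\<close>, so the ideals
  differ by \<open>v\<close> alone. Transporting the edge below \<open>v\<close> along a chain from \<open>v \<sqinter> x\<close> to \<open>x\<close> turns it
  into the edge from \<open>x\<close> to \<open>y\<close>, which therefore has the color of \<open>v\<close>.\<close>

lemma ideal_cover:
  assumes c: "covers L y x"
  shows "\<exists>v. v \<notin> ideal x \<and> ideal y = insert v (ideal x) \<and> j_color L col v = col (x, y)"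
proof -
  note cD = coversD[OF c]
  obtain v where v: "join_irreducible L v" "covers L v (v \<sqinter> x)" "v \<sqsubseteq> y" "\<not> v \<sqsubseteq> x"
    and below: "\<And>z. z \<in> carrier L \<Longrightarrow> z \<sqsubseteq> v \<Longrightarrow> z \<noteq> v \<Longrightarrow> z \<sqsubseteq> x"
    using ex_separating_join_irreducible[OF cD(1,2,5)] by blast
  have vc: "v \<in> carrier L" using v(1) by (rule join_irreducible_carrier)
  obtain M where "chain (v \<sqinter> x) x M"
    using ex_chain[of "v \<sqinter> x" x] vc cD meet_right by auto
  note tr = chain_transport[OF this v(2,4)]
  have "v \<squnion> x = x \<or> v \<squnion> x = y"
    using covers_between[OF c, of "v \<squnion> x"] join_right[of v x] join_le[of v y x] v vc cD by auto
  then have y: "v \<squnion> x = y" using join_left[of v x] v(4) vc cD by auto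
  have "(THE x'. covers L v x') = v \<sqinter> x"
    using v(1,2) unfolding join_irreducible_def by (intro the1_equality) auto
  then have color: "j_color L col v = col (x, y)" using tr(2) y by (simp add: j_color_def)
  have "v \<notin> ideal x" using v by (simp add: ideal_of_eq)
  moreover have "ideal y = insert v (ideal x)"
  proof -
    have "ideal v \<subseteq> insert v (ideal x)"
      using below join_irreducible_carrier by (auto simp: ideal_of_eq)
    moreover have "v \<in> ideal v" using v(1) vc by (simp add: ideal_of_eq)
    moreover have "ideal y = ideal v \<union> ideal x" using ideal_join[of v x] y vc cD by simp
    ultimately show ?thesis by blast
  qed
  ultimately show ?thesis using color by blast
qed

lemma chain_colors_ideal:
  assumes "chain x y M"
  shows "count M i = card {v \<in> ideal y - ideal x. j_color L col v = i}"
  using assms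
proof induction
  case (step a x y M)
  obtain v where v: "v \<notin> ideal x" "ideal a = insert v (ideal x)" "j_color L col v = col (x, a)"
    using ideal_cover[OF step(1)] by blast
  let ?D = "\<lambda>x. {w \<in> ideal y - ideal x. j_color L col w = i}"
  have "ideal a \<subseteq> ideal y" using chainD[OF step(2)] ideal_mono by simp
  then have "?D x = (if col (x, a) = i then insert v (?D a) else ?D a)"
    using v by auto
  moreover have "v \<notin> ?D a" "finite (?D a)" using v finite_ideal by auto
  ultimately show ?case using step.IH by simp
qed simp

lemma bottom_least:
  assumes "carrier L \<noteq> {}"
  shows "least L \<bottom> (carrier L)"
proof -
  obtain m where m: "minimal_elem L (carrier L) m"
    using ex_minimal_elem[of "carrier L"] finite_carrier assms by auto
  have "m \<sqsubseteq> x" if "x \<in> carrier L" for x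
    using m that meet_left[of m x] meet_right[of m x] by (auto simp: minimal_elem_def lless_iff)
  then have "least L m (carrier L)" using m by (auto simp: least_def minimal_elem_def)
  then show ?thesis unfolding bottom_def by (rule someI)
qed

lemma rank_eq_card_ideal:
  assumes "x \<in> carrier L"
  shows "\<rho> x = card (ideal x)"
proof -
  have bot: "\<bottom> \<in> carrier L" "\<And>y. y \<in> carrier L \<Longrightarrow> \<bottom> \<sqsubseteq> y"
    using bottom_least assms by (auto simp: least_def)
  have "ideal \<bottom> = {}"
  proof -
    have False if p: "join_irreducible L p" "p \<sqsubseteq> \<bottom>" for p
    proof -
      obtain q where q: "covers L p q" using p(1) unfolding join_irreducible_def by blast
      have "p \<sqsubseteq> q" using le_trans[OF p(2) bot(2)] coversD[OF q] bot(1) by simp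
      then show False using coversD[OF q] by simp
    qed
    then show ?thesis by (auto simp: ideal_of_eq)
  qed
  then have rank_bottom: "\<rho> \<bottom> = card (ideal \<bottom>)" using rank by (simp add: is_rank_function_def)
  show ?thesis
    using finite_carrier bot(1) assms bot(2)[OF assms]
  proof (induction rule: le_cover_induct)
    case base
    show ?case by (rule rank_bottom)
  next
    case (step y z)
    then show ?case using ideal_cover[OF step(3)] rank_covers[OF step(3)] finite_ideal by auto
  qed
qed

text \<open>An order ideal is the union of the ideals of its elements, and ideals turn joins into unions.\<close>

lemma order_ideal_is_ideal:
  assumes A: "order_ideal (j_poset L) A" and ne: "carrier L \<noteq> {}"
  shows "\<exists>x\<in>carrier L. ideal x = A"
proof -
  have sub: "A \<subseteq> carrier L" "\<And>p. p \<in> A \<Longrightarrow> join_irreducible L p"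
    using A join_irreducible_carrier by (auto simp: order_ideal_def j_poset_simps)
  have "\<exists>x\<in>carrier L. ideal x = (\<Union>p\<in>B. ideal p)" if "finite B" "B \<subseteq> A" for B
    using that
  proof induction
    case empty
    have "\<bottom> \<in> carrier L" using bottom_least[OF ne] by (auto simp: least_def)
    moreover from this have "ideal \<bottom> = {}"
      using rank_eq_card_ideal[of \<bottom>] rank finite_ideal by (simp add: is_rank_function_def)
    ultimately show ?case by auto
  next
    case (insert p B)
    then obtain x where "x \<in> carrier L" "ideal x = (\<Union>p\<in>B. ideal p)" by auto
    then show ?case using insert.prems sub ideal_join[of p x] by (intro bexI[of _ "p \<squnion> x"]) auto
  qed
  from this[of A] obtain x where x: "x \<in> carrier L" "ideal x = (\<Union>p\<in>A. ideal p)"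
    using finite_subset[OF sub(1) finite_carrier] by blast
  have "(\<Union>p\<in>A. ideal p) = A"
  proof
    show "(\<Union>p\<in>A. ideal p) \<subseteq> A"
      using A unfolding order_ideal_def j_poset_simps ideal_of_eq by blast
    have "p \<in> ideal p" if "p \<in> A" for p using sub that by (auto simp: ideal_of_eq)
    then show "A \<subseteq> (\<Union>p\<in>A. ideal p)" by blast
  qed
  then show ?thesis using x by blast
qed

text \<open>Inclusion of ideals gives \<open>x \<sqsubseteq> y\<close>, and since the ranks differ by one there is no room for an
  element in between.\<close>

lemma arc_if_ideal_step:
  assumes "x \<in> carrier L" "y \<in> carrier L" "ideal_step (ideal x) (ideal y)"
  shows "(x, y) \<in> parcs G"
proof -
  have le: "x \<sqsubseteq> y" using assms by (auto simp: ideal_step_def simp flip: ideal_subset_iff)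
  have rk: "\<rho> y = \<rho> x + 1"
    using assms finite_ideal[of x] by (auto simp: rank_eq_card_ideal ideal_step_def)
  have "x \<noteq> y" using rk by auto
  then obtain z where z: "covers L z x" "z \<sqsubseteq> y"
    using ex_cover_above[OF finite_carrier assms(1,2) le] by blast
  then have "z = y"
    using rank_strict_mono[of z y] rank_covers[OF z(1)] rk assms(2) coversD[OF z(1)] by auto
  then show ?thesis using z arc_iff by simp
qed

section \<open>Shortest paths of order ideals\<close>

text \<open>A sequence of order ideals of the right length that changes by one element at each step is the
  image of a shortest path, because ideals of lattice elements and order ideals correspond.\<close>

lemma ideals_shortest_pathI:
  assumes s: "s \<in> carrier L" and t: "t \<in> carrier L"
    and ends: "Z 0 = ideal s" "Z n = ideal t"
    and ideals: "\<And>j. j \<le> n \<Longrightarrow> order_ideal (j_poset L) (Z j)"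
    and steps: "\<And>j. j < n \<Longrightarrow> ideal_step (Z j) (Z (Suc j)) \<or> ideal_step (Z (Suc j)) (Z j)"
    and n: "n = path_distance G s t"
  shows "ideals_shortest_path G L s Z n t"
proof -
  have inj: "x = y" if "x \<in> carrier L" "y \<in> carrier L" "ideal x = ideal y" for x y
    using that ideal_subset_iff[of x y] ideal_subset_iff[of y x] by (auto intro: le_antisym)
  have "\<exists>f. \<forall>j\<le>n. f j \<in> carrier L \<and> ideal (f j) = Z j"
  proof -
    have "\<forall>j. \<exists>x. j \<le> n \<longrightarrow> x \<in> carrier L \<and> ideal x = Z j"
      using order_ideal_is_ideal[OF ideals] s by blast
    from choice[OF this] show ?thesis by blast
  qed
  then obtain f where f: "\<And>j. j \<le> n \<Longrightarrow> f j \<in> carrier L" "\<And>j. j \<le> n \<Longrightarrow> ideal (f j) = Z j"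
    by blast
  let ?p = "map f [0..<Suc n]"
  have "f 0 = s" "f n = t" using f ends inj s t by simp_all
  moreover have "set ?p \<subseteq> pverts G" using f(1) by (auto simp: pverts_eq)
  moreover have "successively (\<lambda>x y. (x, y) \<in> parcs G \<or> (y, x) \<in> parcs G) ?p"
    unfolding successively_conv_nth
  proof (intro allI impI)
    fix j assume "Suc j < length ?p"
    then have j: "j < n" by simp
    then have "(f j, f (Suc j)) \<in> parcs G \<or> (f (Suc j), f j) \<in> parcs G"
      using steps[OF j] arc_if_ideal_step f by (metis Suc_leI less_imp_le_nat)
    then show "(?p ! j, ?p ! Suc j) \<in> parcs G \<or> (?p ! Suc j, ?p ! j) \<in> parcs G"
      using j by (simp del: upt_Suc)
  qed
  ultimately have "is_path G s ?p t"
    by (simp add: is_path_def hd_map last_map del: upt_Suc)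
  then have "shortest_path G s ?p t" using n by (simp add: shortest_path_def path_length_def)
  moreover have "map ideal ?p = map Z [0..<Suc n]" using f(2) by auto
  ultimately show ?thesis unfolding ideals_shortest_path_def by blast
qed

lemma glued_runs_shortest_path:
  assumes s: "s \<in> carrier L" and t: "t \<in> carrier L"
    and run: "fwd_run R (ideal s) a X" and run': "bwd_run R (ideal t) a b 0 X'"
    and meet: "X a = X' a"
    and ideals: "\<And>j. j \<le> a \<Longrightarrow> order_ideal (j_poset L) (X j)"
    and ideals': "\<And>j. a \<le> j \<Longrightarrow> j \<le> a + b \<Longrightarrow> order_ideal (j_poset L) (X' j)"
    and R: "\<And>A B. R A B \<Longrightarrow> ideal_step A B \<or> ideal_step B A"
    and dist: "a + b = path_distance G s t"
  shows "(\<forall>j\<le>a + b. order_ideal (j_poset L) (glue a X X' j)) \<and>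
    ideals_shortest_path G L s (glue a X X') (a + b) t"
proof
  show ord: "\<forall>j\<le>a + b. order_ideal (j_poset L) (glue a X X' j)"
    using ideals ideals' by (simp add: glue_def)
  show "ideals_shortest_path G L s (glue a X X') (a + b) t"
  proof (rule ideals_shortest_pathI[OF s t])
    show "glue a X X' 0 = ideal s" using run by (simp add: glue_def fwd_run_def)
    show "glue a X X' (a + b) = ideal t" using run' meet by (auto simp: glue_def bwd_run_def)
    fix j assume j: "j < a + b"
    show "ideal_step (glue a X X' j) (glue a X X' (Suc j)) \<or>
          ideal_step (glue a X X' (Suc j)) (glue a X X' j)"
    proof (cases "j < a")
      case True
      then show ?thesis using R[OF fwd_run_step[OF run]] by (simp add: glue_def)
    next
      case False
      have "\<forall>k\<in>{1..b}. R (X' (a + k)) (X' (a + k - 1))"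
        using run' by (simp add: bwd_run_def)
      from bspec[OF this, of "Suc j - a"] have "R (X' (Suc j)) (X' j)"
        using False j by (simp add: Suc_diff_le)
      moreover have "glue a X X' j = X' j" "glue a X X' (Suc j) = X' (Suc j)"
        using False meet by (auto simp: glue_def)
      ultimately show ?thesis using R by auto
    qed
  qed (use ord dist in auto)
qed

lemma finite_j_poset: "finite (carrier (j_poset L))"
  using finite_subset[OF _ finite_carrier, of "carrier (j_poset L)"] join_irreducible_carrier
  by (auto simp: j_poset_simps)

lemma path_distance_ideals:
  assumes "s \<in> carrier L" "t \<in> carrier L"
  shows "path_distance G s t =
      (card (ideal s \<union> ideal t) - card (ideal s)) + (card (ideal s \<union> ideal t) - card (ideal t))"
    and "path_distance G s t =
      (card (ideal s) - card (ideal s \<inter> ideal t)) + (card (ideal t) - card (ideal s \<inter> ideal t))"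
proof -
  have eq: "\<rho> s = card (ideal s)" "\<rho> t = card (ideal t)"
    "\<rho> (s \<squnion> t) = card (ideal s \<union> ideal t)" "\<rho> (s \<sqinter> t) = card (ideal s \<inter> ideal t)"
    using rank_eq_card_ideal assms by (simp_all flip: ideal_join ideal_meet)
  have le: "\<rho> s \<le> \<rho> (s \<squnion> t)" "\<rho> t \<le> \<rho> (s \<squnion> t)" "\<rho> (s \<sqinter> t) \<le> \<rho> s" "\<rho> (s \<sqinter> t) \<le> \<rho> t"
    using rank_mono assms join_left join_right meet_left meet_right by simp_all
  show "path_distance G s t =
      (card (ideal s \<union> ideal t) - card (ideal s)) + (card (ideal s \<union> ideal t) - card (ideal t))"
    using path_distance_join[OF assms] le unfolding eq by linarith
  show "path_distance G s t =
      (card (ideal s) - card (ideal s \<inter> ideal t)) + (card (ideal t) - card (ideal s \<inter> ideal t))"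
    using path_distance_join[OF assms] rank_meet_join[OF assms] le unfolding eq by linarith
qed

text \<open>A run that starts at \<open>S\<close> or \<open>T\<close> stays inside \<open>S \<union> T\<close> and gains one element per step. Counting shows
  that it can go on as long as fewer steps than prescribed have been made, and that it has reached
  \<open>S \<union> T\<close> after the last one. Hence both phases meet, and their lengths add up to the distance.\<close>

lemma adding_minimal_elements:
  assumes s: "s \<in> carrier L" and t: "t \<in> carrier L"
  defines "U \<equiv> ideal s \<union> ideal t"
  defines "R \<equiv> adds_minimal (j_poset L) U"
    and "l1 \<equiv> card U - card (ideal s)" and "l2 \<equiv> card U - card (ideal t)"
  shows "j \<in> {1..l1} \<Longrightarrow> fwd_run R (ideal s) (j - 1) X \<Longrightarrow>
      \<exists>u. minimal_elem (j_poset L) (U - X (j - 1)) u"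
    and "j \<in> {1..l2} \<Longrightarrow> bwd_run R (ideal t) l1 l2 j X' \<Longrightarrow>
      \<exists>u. minimal_elem (j_poset L) (U - X' (l1 + j)) u"
    and "fwd_run R (ideal s) l1 X \<Longrightarrow> bwd_run R (ideal t) l1 l2 0 X' \<Longrightarrow>
      X l1 = U \<and> X' l1 = U \<and> (\<forall>j\<le>l1 + l2. order_ideal (j_poset L) (glue l1 X X' j)) \<and>
      ideals_shortest_path G L s (glue l1 X X') (l1 + l2) t"
proof -
  interpret J: partial_order "j_poset L" by (rule partial_order_j_poset)
  have U: "order_ideal (j_poset L) U" "finite U"
    using order_ideal_ideal_of[of "s \<squnion> t"] ideal_join s t finite_ideal by (simp_all add: U_def)
  \<comment> \<open>The letter \<open>r\<close> stands for \<open>s\<close> or \<open>t\<close>: the second phase, read backwards, is a run from \<open>t\<close>.\<close>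
  have invar: "order_ideal (j_poset L) (Z j) \<and> Z j \<subseteq> U \<and> card (Z j) = card (ideal r) + j"
    if "fwd_run R (ideal r) n Z" "r \<in> {s, t}" "j \<le> n" for r n Z j
    using J.adds_minimal_run[OF finite_j_poset order_ideal_ideal_of U(1), of r n Z j] that s t
    by (auto simp: R_def U_def)
  have progress: "\<exists>u. minimal_elem (j_poset L) (U - Z n) u"
    if run: "fwd_run R (ideal r) n Z" and r: "r \<in> {s, t}" and less: "n < card U - card (ideal r)"
    for r n Z
  proof (rule J.ex_minimal_elem)
    have "card (Z n) < card U" using invar[OF run r order_refl] less by simp
    then show "U - Z n \<noteq> {}" using invar[OF run r order_refl] by auto
    show "U - Z n \<subseteq> carrier (j_poset L)" using U by (auto simp: order_ideal_def)
  qed (use U in simp)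
  have complete: "Z n = U"
    if run: "fwd_run R (ideal r) n Z" and r: "r \<in> {s, t}" and n: "n = card U - card (ideal r)"
    for r n Z
  proof (rule card_subset_eq[OF U(2)])
    have "card (ideal r) \<le> card U" using r U(2) by (auto simp: U_def intro: card_mono)
    then show "card (Z n) = card U" using invar[OF run r order_refl] n by simp
  qed (use invar[OF run r order_refl] in simp)
  show "\<exists>u. minimal_elem (j_poset L) (U - X (j - 1)) u"
    if "j \<in> {1..l1}" "fwd_run R (ideal s) (j - 1) X"
    using progress[OF that(2)] that(1) by (auto simp: l1_def)
  show "\<exists>u. minimal_elem (j_poset L) (U - X' (l1 + j)) u"
    if j: "j \<in> {1..l2}" and run: "bwd_run R (ideal t) l1 l2 j X'"
    using progress[OF bwd_run_imp_fwd_run[OF run]] j by (auto simp: l2_def)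
  show "X l1 = U \<and> X' l1 = U \<and> (\<forall>j\<le>l1 + l2. order_ideal (j_poset L) (glue l1 X X' j)) \<and>
      ideals_shortest_path G L s (glue l1 X X') (l1 + l2) t"
    if run: "fwd_run R (ideal s) l1 X" and run': "bwd_run R (ideal t) l1 l2 0 X'"
  proof -
    have rev: "fwd_run R (ideal t) l2 (\<lambda>k. X' (l1 + l2 - k))"
      using bwd_run_imp_fwd_run[OF run'] by simp
    have X: "X l1 = U" using complete[OF run] by (simp add: l1_def)
    have X': "X' l1 = U" using complete[OF rev] by (simp add: l2_def)
    have "order_ideal (j_poset L) (X' j)" if "l1 \<le> j" "j \<le> l1 + l2" for j
      using invar[OF rev, of "l1 + l2 - j"] that by simp
    then have "(\<forall>j\<le>l1 + l2. order_ideal (j_poset L) (glue l1 X X' j)) \<and>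
        ideals_shortest_path G L s (glue l1 X X') (l1 + l2) t"
      using invar[OF run] path_distance_ideals(1)[OF s t] X X'
      by (intro glued_runs_shortest_path[OF s t run run']) (auto simp: l1_def l2_def U_def R_def intro: adds_minimal_step)
    then show ?thesis using X X' by blast
  qed
qed

text \<open>The same count as for adding minimal elements, with sizes decreasing to that of \<open>S \<inter> T\<close>.\<close>

lemma removing_maximal_elements:
  assumes s: "s \<in> carrier L" and t: "t \<in> carrier L"
  defines "W \<equiv> ideal s \<inter> ideal t"
  defines "R \<equiv> removes_maximal (j_poset L) W"
    and "k1 \<equiv> card (ideal s) - card W" and "k2 \<equiv> card (ideal t) - card W"
  shows "j \<in> {1..k1} \<Longrightarrow> fwd_run R (ideal s) (j - 1) Y \<Longrightarrow>
      \<exists>u. maximal_elem (j_poset L) (Y (j - 1) - W) u"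
    and "j \<in> {1..k2} \<Longrightarrow> bwd_run R (ideal t) k1 k2 j Y' \<Longrightarrow>
      \<exists>u. maximal_elem (j_poset L) (Y' (k1 + j) - W) u"
    and "fwd_run R (ideal s) k1 Y \<Longrightarrow> bwd_run R (ideal t) k1 k2 0 Y' \<Longrightarrow>
      Y k1 = W \<and> Y' k1 = W \<and> ideals_shortest_path G L s (glue k1 Y Y') (k1 + k2) t"
proof -
  interpret J: partial_order "j_poset L" by (rule partial_order_j_poset)
  have W: "order_ideal (j_poset L) W" "finite W"
    using order_ideal_ideal_of[of "s \<sqinter> t"] ideal_meet s t finite_ideal by (simp_all add: W_def)
  have invar: "order_ideal (j_poset L) (Z j) \<and> W \<subseteq> Z j \<and> Z j \<subseteq> ideal r \<and>
      card (Z j) + j = card (ideal r)"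
    if "fwd_run R (ideal r) n Z" "r \<in> {s, t}" "j \<le> n" for r n Z j
    using J.removes_maximal_run[OF finite_j_poset order_ideal_ideal_of W(1), of r n Z j] that s t
    by (auto simp: R_def W_def)
  have progress: "\<exists>u. maximal_elem (j_poset L) (Z n - W) u"
    if run: "fwd_run R (ideal r) n Z" and r: "r \<in> {s, t}" and less: "n < card (ideal r) - card W"
    for r n Z
  proof (rule J.ex_maximal_elem)
    note inv = invar[OF run r order_refl]
    have "card (Z n) + n = card (ideal r)" using inv by simp
    then have "card W < card (Z n)" using less by linarith
    then show "Z n - W \<noteq> {}" using inv by auto
    show "Z n - W \<subseteq> carrier (j_poset L)" using inv by (auto simp: order_ideal_def)
    show "finite (Z n - W)" using finite_subset[OF _ finite_ideal] inv by blast
  qed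
  have complete: "Z n = W"
    if run: "fwd_run R (ideal r) n Z" and r: "r \<in> {s, t}" and n: "n = card (ideal r) - card W"
    for r n Z
  proof (rule card_subset_eq[symmetric])
    note inv = invar[OF run r order_refl]
    show "finite (Z n)" using finite_subset[OF _ finite_ideal] inv by blast
    have "card W \<le> card (ideal r)" using r finite_ideal by (auto simp: W_def intro: card_mono)
    moreover have "card (Z n) + n = card (ideal r)" using inv by simp
    ultimately show "card W = card (Z n)" using n by linarith
    show "W \<subseteq> Z n" using inv by simp
  qed
  show "\<exists>u. maximal_elem (j_poset L) (Y (j - 1) - W) u"
    if "j \<in> {1..k1}" "fwd_run R (ideal s) (j - 1) Y"
    using progress[OF that(2)] that(1) by (auto simp: k1_def)
  show "\<exists>u. maximal_elem (j_poset L) (Y' (k1 + j) - W) u"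
    if j: "j \<in> {1..k2}" and run: "bwd_run R (ideal t) k1 k2 j Y'"
    using progress[OF bwd_run_imp_fwd_run[OF run]] j by (auto simp: k2_def)
  show "Y k1 = W \<and> Y' k1 = W \<and> ideals_shortest_path G L s (glue k1 Y Y') (k1 + k2) t"
    if run: "fwd_run R (ideal s) k1 Y" and run': "bwd_run R (ideal t) k1 k2 0 Y'"
  proof -
    have rev: "fwd_run R (ideal t) k2 (\<lambda>k. Y' (k1 + k2 - k))"
      using bwd_run_imp_fwd_run[OF run'] by simp
    have Y: "Y k1 = W" using complete[OF run] by (simp add: k1_def)
    have Y': "Y' k1 = W" using complete[OF rev] by (simp add: k2_def)
    have "order_ideal (j_poset L) (Y' j)" if "k1 \<le> j" "j \<le> k1 + k2" for j
      using invar[OF rev, of "k1 + k2 - j"] that by simp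
    then have "(\<forall>j\<le>k1 + k2. order_ideal (j_poset L) (glue k1 Y Y' j)) \<and>
        ideals_shortest_path G L s (glue k1 Y Y') (k1 + k2) t"
      using invar[OF run] path_distance_ideals(2)[OF s t] Y Y'
      by (intro glued_runs_shortest_path[OF s t run run']) (auto simp: k1_def k2_def W_def R_def intro: removes_maximal_step)
    then show ?thesis using Y Y' by blast
  qed
qed

end

section \<open>Distances and colors of shortest paths\<close>

theorem theorem4p1:
  fixes G :: "'a pair_pre_digraph"
    and I :: "'i set"
    and col :: "'a \<times> 'a \<Rightarrow> 'i"
    and L :: "('a, 'm) gorder_scheme"
    and \<rho> :: "'a \<Rightarrow> nat"
    and s t :: 'a
    and P :: "('a, 'm) gorder_scheme"
    and S T :: "'a set"
  assumes "pair_digraph G"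
    and "finite I"
    and "edge_colored_by G col I"
    and "modular_lattice L"
    and "is_order_diagram G L"
    and "diamond_colored G col"
    and "is_rank_function L \<rho>"
    and "s \<in> pverts G"
    and "t \<in> pverts G"
    and "P = j_poset L"
    and "S = ideal_of L s"
    and "T = ideal_of L t"
  shows
    "(\<exists>p. is_path G s p t)
   \<and>
     (int (path_distance G s t) = 2 * int (\<rho> (s \<squnion>\<^bsub>L\<^esub> t)) - int (\<rho> s) - int (\<rho> t) \<and>
      int (path_distance G s t) = int (\<rho> s) + int (\<rho> t) - 2 * int (\<rho> (s \<sqinter>\<^bsub>L\<^esub> t)) \<and>
      (distributive_lattice L \<longrightarrow>
         \<rho> s = card S \<and> \<rho> t = card T \<and>
         \<rho> (s \<squnion>\<^bsub>L\<^esub> t) = card (S \<union> T) \<and> \<rho> (s \<sqinter>\<^bsub>L\<^esub> t) = card (S \<inter> T)))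
   \<and>
     (\<forall>i\<in>I.
        (\<forall>p q. shortest_path G s p t \<and> shortest_path G s q t \<longrightarrow>
           color_count G col i p = color_count G col i q) \<and>
        (distributive_lattice L \<longrightarrow>
           (\<forall>p. shortest_path G s p t \<longrightarrow>
              color_count G col i p =
                card {v \<in> (S \<union> T) - S. j_color L col v = i} +
                card {v \<in> (S \<union> T) - T. j_color L col v = i} \<and>
              color_count G col i p =
                card {v \<in> S - (S \<inter> T). j_color L col v = i} +
                card {v \<in> T - (S \<inter> T). j_color L col v = i})))
   \<and>
     (distributive_lattice L \<longrightarrow>
        (let l1 = card (S \<union> T) - card S;
             l2 = card (S \<union> T) - card T;
             R = adds_minimal P (S \<union> T)
         in
           (\<forall>X. \<forall>j\<in>{1..l1}. fwd_run R S (j - 1) X \<longrightarrow>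
              (\<exists>u. minimal_elem P ((S \<union> T) - X (j - 1)) u)) \<and>
           (\<forall>X'. \<forall>j\<in>{1..l2}. bwd_run R T l1 l2 j X' \<longrightarrow>
              (\<exists>u. minimal_elem P ((S \<union> T) - X' (l1 + j)) u)) \<and>
           (\<forall>X X'. fwd_run R S l1 X \<and> bwd_run R T l1 l2 0 X' \<longrightarrow>
              X l1 = S \<union> T \<and> X' l1 = S \<union> T \<and>
              (\<forall>j\<le>l1 + l2. order_ideal P (glue l1 X X' j)) \<and>
              ideals_shortest_path G L s (glue l1 X X') (l1 + l2) t))
      \<and>
        (let k1 = card S - card (S \<inter> T);
             k2 = card T - card (S \<inter> T);
             R = removes_maximal P (S \<inter> T)
         in
           (\<forall>Y. \<forall>j\<in>{1..k1}. fwd_run R S (j - 1) Y \<longrightarrow>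
              (\<exists>u. maximal_elem P (Y (j - 1) - (S \<inter> T)) u)) \<and>
           (\<forall>Y'. \<forall>j\<in>{1..k2}. bwd_run R T k1 k2 j Y' \<longrightarrow>
              (\<exists>u. maximal_elem P (Y' (k1 + j) - (S \<inter> T)) u)) \<and>
           (\<forall>Y Y'. fwd_run R S k1 Y \<and> bwd_run R T k1 k2 0 Y' \<longrightarrow>
              Y k1 = S \<inter> T \<and> Y' k1 = S \<inter> T \<and>
              ideals_shortest_path G L s (glue k1 Y Y') (k1 + k2) t)))"
proof -
  interpret lattice L using assms(4) by (simp add: modular_lattice_def)
  interpret pair_digraph G by (rule assms(1))
  have fin: "finite (carrier L)"
  proof -
    have "pverts G = carrier L" using assms(5) by (simp add: is_order_diagram_def)
    then show ?thesis using pair_finite_verts by (rule subst)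
  qed
  interpret Mod: modular_order_diagram L G col \<rho>
    by unfold_locales (fact assms fin)+
  have s: "s \<in> carrier L" and t: "t \<in> carrier L" using assms(8,9) Mod.pverts_eq by simp_all
  obtain M where M: "Mod.chain s (s \<squnion>\<^bsub>L\<^esub> t) M"
    using Mod.ex_chain[of s "s \<squnion>\<^bsub>L\<^esub> t"] s t join_left by auto
  obtain N where N: "Mod.chain t (s \<squnion>\<^bsub>L\<^esub> t) N"
    using Mod.ex_chain[of t "s \<squnion>\<^bsub>L\<^esub> t"] s t join_right by auto
  have colors: "color_count G col i p = count (M + N) i" if "shortest_path G s p t" for p i
    using Mod.color_count_shortest_path[OF _ _ t M N] that Mod.shortest_path_iff[OF s t] by blast
  have path: "\<exists>p. is_path G s p t" using Mod.ex_path[OF s t] by blast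
  have dist: "int (path_distance G s t) = 2 * int (\<rho> (s \<squnion>\<^bsub>L\<^esub> t)) - int (\<rho> s) - int (\<rho> t)"
    "int (path_distance G s t) = int (\<rho> s) + int (\<rho> t) - 2 * int (\<rho> (s \<sqinter>\<^bsub>L\<^esub> t))"
    using Mod.path_distance_join[OF s t] Mod.rank_meet_join[OF s t] by linarith+
  \<comment> \<open>\<open>M\<close> and \<open>N\<close> do not depend on the path, which settles the comparison of two shortest paths.\<close>
  show ?thesis
  proof (cases "distributive_lattice L")
    case False
    then show ?thesis using path dist colors by simp
  next
    case True
    interpret Dist: distributive_order_diagram L G col \<rho>
      by unfold_locales (rule True)
    note ideal_join = Dist.ideal_join[OF s t] and ideal_meet = Dist.ideal_meet[OF s t]
    have ranks: "\<rho> s = card S" "\<rho> t = card T"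
      "\<rho> (s \<squnion>\<^bsub>L\<^esub> t) = card (S \<union> T)" "\<rho> (s \<sqinter>\<^bsub>L\<^esub> t) = card (S \<inter> T)"
      using Dist.rank_eq_card_ideal s t ideal_join ideal_meet unfolding assms(11,12) by simp_all
    have counts: "color_count G col i p =
        card {v \<in> (S \<union> T) - S. j_color L col v = i} +
        card {v \<in> (S \<union> T) - T. j_color L col v = i}"
      if "shortest_path G s p t" for p i
      using colors[OF that] Dist.chain_colors_ideal[OF M] Dist.chain_colors_ideal[OF N]
      unfolding assms(11,12) ideal_join by simp
    have "(S \<union> T) - S = T - (S \<inter> T)" "(S \<union> T) - T = S - (S \<inter> T)" by auto
    then have counts': "color_count G col i p =
        card {v \<in> S - (S \<inter> T). j_color L col v = i} +
        card {v \<in> T - (S \<inter> T). j_color L col v = i}"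
      if "shortest_path G s p t" for p i
      using counts[OF that] by (simp only: add.commute)
    note adding = Dist.adding_minimal_elements[OF s t, folded assms(10-12)]
      and removing = Dist.removing_maximal_elements[OF s t, folded assms(10-12)]
    show ?thesis
      unfolding Let_def
    proof (intro conjI, goal_cases)
      case 1
      show ?case by (rule path)
    next
      case 2
      show ?case by (rule dist(1))
    next
      case 3
      show ?case by (rule dist(2))
    next
      case 4
      show ?case using ranks by simp
    next
      case 5
      show ?case
        by (intro ballI conjI allI impI; (elim conjE)?; (rule counts counts')?; simp only: colors)
    next
      case 6
      show ?case
      proof (intro impI conjI, goal_cases)
        case 1
        show ?case by (intro allI ballI impI) (rule adding(1))
      next
        case 2
        show ?case by (intro allI ballI impI) (rule adding(2))
      next
        case 3
        show ?case by (intro allI impI, elim conjE) (rule adding(3))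
      next
        case 4
        show ?case by (intro allI ballI impI) (rule removing(1))
      next
        case 5
        show ?case by (intro allI ballI impI) (rule removing(2))
      next
        case 6
        show ?case by (intro allI impI, elim conjE) (rule removing(3))
      qed
    qed
  qed
qed

end
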